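(* Let $X: M^m \to \mathbb{R}^{m+n}_n$ be an $m$-dimensional spacelike entire self-shrinking graph. Assume that the origin $o$ of $\mathbb{R}^{m+n}_n$ belongs to $M^m$. Suppose that there are a real number $\alpha < \frac{1}{6}+\frac{1}{6\sqrt{m}}$ and a positive constant $C$ such that the mean curvature vector $H$ satisfies $\|H\|^2 \leq C e^{\alpha z}$ on $M^m$. Then $M^m$ must be a linear subspace of $\mathbb{R}^{m+n}_n$.
   Context: $\mathbb{R}^{m+n}_n$ is the linear space $\mathbb{R}^{m+n}$ with the indefinite inner product $\langle a,b\rangle=\sum_{i=1}^m a_ib_i-\sum_{\alpha=m+1}^{m+n}a_\alpha b_\alpha$; for a vector $a$, $\|a\|:=\sqrt{|\langle a,a\rangle|}$. An $m$-dimensional submanifold $M^m$ (smooth, with position vector $X$) is spacelike if the induced metric is Riemannian. It is an entire graph if $M^m=\{(x,u(x)) : x\in\mathbb{R}^m\}$ for a smooth map $u=(u^1,\dots,u^n):\mathbb{R}^m\to\mathbb{R}^n$. The second fundamental form is $B_{UW}=(\overline{\nabla}_UW)^N$, where $\overline\nabla$ is the flat connection and $(\cdot)^N$ is the orthogonal projection onto the normal bundle, and $H=\sum_{i=1}^m B_{e_ie_i}$ for a local orthonormal frame $\{e_i\}$ of $TM^m$ is the mean curvature vector. $M^m$ is a self-shrinker (self-shrinking) if $H=-\frac12X^N$. The function $z$ is $z=\langle X,X\rangle$. *)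

theory Defs
  imports "HOL-Analysis.Analysis"
begin

text \<open>
  The space of signature (m, n) is modelled as \<open>real^'m \<times> real^'n\<close>, with the first m coordinates
  (the positive directions) in the first factor.
\<close>

definition pseudo_inner :: "(real^'m) \<times> (real^'n) \<Rightarrow> (real^'m) \<times> (real^'n) \<Rightarrow> real" where
  "pseudo_inner a b = (\<Sum>i\<in>UNIV. fst a $ i * fst b $ i) - (\<Sum>j\<in>UNIV. snd a $ j * snd b $ j)"

definition pseudo_norm :: "(real^'m) \<times> (real^'n) \<Rightarrow> real" where
  "pseudo_norm a = sqrt \<bar>pseudo_inner a a\<bar>"

text \<open>\<open>Ck_on k S f\<close> is k-fold continuous differentiability; it is only meant for open \<open>S\<close>.\<close>

primrec Ck_on ::
  "nat \<Rightarrow> 'a::euclidean_space set \<Rightarrow> ('a \<Rightarrow> 'b::euclidean_space) \<Rightarrow> bool" where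
  "Ck_on 0 S f \<longleftrightarrow> continuous_on S f"
| "Ck_on (Suc k) S f \<longleftrightarrow>
     (\<forall>x\<in>S. f differentiable (at x)) \<and> (\<forall>v. Ck_on k S (\<lambda>x. frechet_derivative f (at x) v))"

definition smooth_on :: "'a::euclidean_space set \<Rightarrow> ('a \<Rightarrow> 'b::euclidean_space) \<Rightarrow> bool" where
  "smooth_on S f \<longleftrightarrow> (\<forall>k. Ck_on k S f)"

text \<open>
  A submanifold diffeomorphic to \<open>real^'m\<close> is described by an immersion \<open>X\<close> of \<open>real^'m\<close>; \<open>X\<close> is
  then also its position vector. The point \<open>X x\<close> is addressed by its parameter \<open>x\<close>. A tangent
  vector at \<open>X x\<close> is represented by the \<open>v\<close> with \<open>push X x v\<close> equal to it, and a tangent vector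
  field accordingly by a function from \<open>real^'m\<close> to \<open>real^'m\<close>.
\<close>

definition push ::
  "(real^'m \<Rightarrow> (real^'m) \<times> (real^'n)) \<Rightarrow> real^'m \<Rightarrow> real^'m \<Rightarrow> (real^'m) \<times> (real^'n)" where
  "push X x v = frechet_derivative X (at x) v"

definition tangent_space ::
  "(real^'m \<Rightarrow> (real^'m) \<times> (real^'n)) \<Rightarrow> real^'m \<Rightarrow> ((real^'m) \<times> (real^'n)) set" where
  "tangent_space X x = range (push X x)"

definition normal_space ::
  "(real^'m \<Rightarrow> (real^'m) \<times> (real^'n)) \<Rightarrow> real^'m \<Rightarrow> ((real^'m) \<times> (real^'n)) set" where
  "normal_space X x = {w. \<forall>t \<in> tangent_space X x. pseudo_inner w t = 0}"

text \<open>
  The description determines a unique vector when the induced metric at \<open>x\<close> is nondegenerate, in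
  particular for spacelike \<open>X\<close>.
\<close>

definition normal_part ::
  "(real^'m \<Rightarrow> (real^'m) \<times> (real^'n)) \<Rightarrow> real^'m \<Rightarrow> (real^'m) \<times> (real^'n) \<Rightarrow> (real^'m) \<times> (real^'n)"
  where
  "normal_part X x a = (THE w. w \<in> normal_space X x \<and> a - w \<in> tangent_space X x)"

definition induced_metric ::
  "(real^'m \<Rightarrow> (real^'m) \<times> (real^'n)) \<Rightarrow> real^'m \<Rightarrow> real^'m \<Rightarrow> real^'m \<Rightarrow> real" where
  "induced_metric X x v w = pseudo_inner (push X x v) (push X x w)"

definition spacelike :: "(real^'m \<Rightarrow> (real^'m) \<times> (real^'n)) \<Rightarrow> bool" where
  "spacelike X \<longleftrightarrow> (\<forall>x v. v \<noteq> 0 \<longrightarrow> induced_metric X x v v > 0)"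

text \<open>
  The normal part of the flat derivative, in the direction of \<open>push X x (U x)\<close>, of the tangent field
  represented by \<open>W\<close>.
\<close>

definition second_fundamental_form ::
  "(real^'m \<Rightarrow> (real^'m) \<times> (real^'n)) \<Rightarrow> (real^'m \<Rightarrow> real^'m) \<Rightarrow> (real^'m \<Rightarrow> real^'m) \<Rightarrow>
     real^'m \<Rightarrow> (real^'m) \<times> (real^'n)" where
  "second_fundamental_form X U W x =
     normal_part X x (frechet_derivative (\<lambda>y. push X y (W y)) (at x) (U x))"

definition local_orthonormal_frame ::
  "(real^'m \<Rightarrow> (real^'m) \<times> (real^'n)) \<Rightarrow> (real^'m) set \<Rightarrow> ('m \<Rightarrow> real^'m \<Rightarrow> real^'m) \<Rightarrow> bool" where
  "local_orthonormal_frame X S e \<longleftrightarrow>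
     open S \<and> (\<forall>i. smooth_on S (e i)) \<and>
     (\<forall>y\<in>S. \<forall>i j. induced_metric X y (e i y) (e j y) = (if i = j then 1 else 0))"

text \<open>
  For smooth spacelike \<open>X\<close>, local orthonormal frames exist around every point (Gram-Schmidt), and
  the sum does not depend on the frame.
\<close>

definition mean_curvature ::
  "(real^'m \<Rightarrow> (real^'m) \<times> (real^'n)) \<Rightarrow> real^'m \<Rightarrow> (real^'m) \<times> (real^'n)" where
  "mean_curvature X x =
     (THE h. \<exists>S e. x \<in> S \<and> local_orthonormal_frame X S e \<and>
        h = (\<Sum>i\<in>UNIV. second_fundamental_form X (e i) (e i) x))"

definition self_shrinker :: "(real^'m \<Rightarrow> (real^'m) \<times> (real^'n)) \<Rightarrow> bool" where
  "self_shrinker X \<longleftrightarrow> (\<forall>x. mean_curvature X x = - (1/2) *\<^sub>R normal_part X x (X x))"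

definition z_fun :: "(real^'m \<Rightarrow> (real^'m) \<times> (real^'n)) \<Rightarrow> real^'m \<Rightarrow> real" where
  "z_fun X x = pseudo_inner (X x) (X x)"

definition graph_immersion :: "(real^'m \<Rightarrow> real^'n) \<Rightarrow> real^'m \<Rightarrow> (real^'m) \<times> (real^'n)" where
  "graph_immersion u x = (x, u x)"

end

(*
  For a graph, self-shrinking is the elliptic system g^{ij} u_ij = (Du x - u)/2. In the coordinates
  x the drift Laplacian is L = g^{ij} D_i D_j - (1/2) x . D, and L z = 2m - z.

  Let F = -<X^N, X^N> = 4 ||H||^2. A Simons type computation gives
  L F >= F + 2 |A|^2 + 2 sum_i ||B(e_i, X^T)||^2 with A = <B, X^N>, tr A = F/2. Suppose that F exp(-h(z))
  has a positive maximum. At this point the gradient condition says that X^T is an eigenvector of A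
  with eigenvalue h' F, so |A|^2 >= (h' F)^2 + ((1/2 - h') F)^2 / m, which absorbs the contribution of
  |grad z|^2 = 4 (z + F) as long as h' < 1/2 and h'' is small. The weight
  h(z) = (2/5) (z - K ln (z + K)) with large K turns the inequality into a contradiction. The maximum
  exists because z is proper and F <= 4 C exp(alpha z) with alpha <= 1/3 < 2/5. Hence F = 0, so
  u = Du x is homogeneous of degree one, and being smooth at 0 it is linear.

  The functions F and g^{-1} are never differentiated: F(x) is the maximum over tangent vectors a of
  -<X - a, X - a>, so at a maximum point F may be replaced by a lower barrier in which a depends
  affinely on x.
*)

theory Submission
  imports Defs "HOL-Real_Asymp.Real_Asymp"
begin

section \<open>Calculus of smooth maps\<close>

text \<open>The limit 1/2 for h' comes from the terms in z: after the absorption they amount to 2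
  h'^2 z - h' z, which for z > 0 is negative exactly when 0 < h' < 1/2. Since m >= 1, the hypothesis
  keeps \<alpha> at or below 1/3, so an asymptotic slope 2/5 fits between the growth of F and this
  limit. A constant slope 2/5 could fail near z = 0, where 2 m h' is not compensated by - h' z. The
  logarithm makes h' vanish at z = 0 and rise slowly; the price is h'' <= 2 / (5 K), and 2 (1/2 -
  h')^2 F / m pays for it.

  Orthonormal frames take the place of the inverse metric: g^{ij} u_ij is a trace over a frame.
  Differentiating that trace involves only the symmetric part of the derivative of the frame, which
  orthonormality determines. The normal part and the mean curvature are definite descriptions, so
  uniqueness of the projection, existence of smooth frames and independence of the frame come before
  the equation.\<close>

definition dd :: "('a::euclidean_space \<Rightarrow> 'b::euclidean_space) \<Rightarrow> 'a \<Rightarrow> 'a \<Rightarrow> 'b" where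
  "dd f v x = frechet_derivative f (at x) v"

lemma Ck_on_Suc_UNIV:
  "Ck_on (Suc k) UNIV f \<longleftrightarrow> (\<forall>x. f differentiable (at x)) \<and> (\<forall>v. Ck_on k UNIV (dd f v))"
  by (simp add: dd_def[abs_def])

lemma Ck_on_Suc_imp: "Ck_on (Suc k) UNIV f \<Longrightarrow> Ck_on k UNIV f"
proof (induction k arbitrary: f)
  case 0
  then show ?case
    by (auto intro!: differentiable_imp_continuous_on simp: differentiable_on_def differentiable_at_withinI)
next
  case (Suc k)
  then show ?case unfolding Ck_on_Suc_UNIV by blast
qed

lemma dd_eqI: "(\<And>x. (f has_derivative f' x) (at x)) \<Longrightarrow> dd f v = (\<lambda>x. f' x v)"
  by (metis dd_def frechet_derivative_at ext)

lemma differentiable_has_dd: "f differentiable (at x) \<Longrightarrow> (f has_derivative (\<lambda>v. dd f v x)) (at x)"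
  unfolding dd_def by (simp flip: frechet_derivative_works)

lemma Ck_on_const: "Ck_on k UNIV (\<lambda>x. c)"
proof (induction k arbitrary: c)
  case (Suc k)
  have "dd (\<lambda>x. c) v = (\<lambda>x. 0)" for v :: 'a by (rule dd_eqI) (rule has_derivative_const)
  then show ?case unfolding Ck_on_Suc_UNIV using Suc by simp
qed simp

lemma Ck_on_add: "Ck_on k UNIV f \<Longrightarrow> Ck_on k UNIV g \<Longrightarrow> Ck_on k UNIV (\<lambda>x. f x + g x)"
proof (induction k arbitrary: f g)
  case 0 then show ?case by (simp add: continuous_on_add)
next
  case (Suc k)
  have d: "dd (\<lambda>x. f x + g x) v = (\<lambda>x. dd f v x + dd g v x)" for v
    using Suc.prems unfolding Ck_on_Suc_UNIV
    by (intro dd_eqI has_derivative_add differentiable_has_dd) auto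
  show ?case using Suc unfolding Ck_on_Suc_UNIV d by (simp add: differentiable_add)
qed

text \<open>Both maps vary in the induction: the derivative is a sum of two products of the same
  shape, with one factor differentiated and the other lowered to class C^k. A general
  \<open>B\<close> covers scalar multiples, inner products and real products at once.\<close>

lemma Ck_on_bilinear:
  assumes B: "bounded_bilinear B"
  shows "Ck_on k UNIV f \<Longrightarrow> Ck_on k UNIV g \<Longrightarrow> Ck_on k UNIV (\<lambda>x. B (f x) (g x))"
proof (induction k arbitrary: f g)
  case 0 then show ?case by (simp add: bounded_bilinear.continuous_on[OF B])
next
  case (Suc k)
  have h: "((\<lambda>x. B (f x) (g x)) has_derivative (\<lambda>v. B (f x) (dd g v x) + B (dd f v x) (g x))) (at x)" for x
    using Suc.prems unfolding Ck_on_Suc_UNIV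
    by (intro bounded_bilinear.FDERIV[OF B] differentiable_has_dd) auto
  have d: "dd (\<lambda>x. B (f x) (g x)) v = (\<lambda>x. B (f x) (dd g v x) + B (dd f v x) (g x))" for v
    using h by (rule dd_eqI)
  show ?case unfolding Ck_on_Suc_UNIV d
    using Suc.prems Ck_on_Suc_imp[OF Suc.prems(1)] Ck_on_Suc_imp[OF Suc.prems(2)] h
    by (auto simp: Ck_on_Suc_UNIV differentiable_def simp del: Ck_on.simps intro!: Ck_on_add Suc.IH)
qed

text \<open>The derivative of r = f^(-1/2) is -(1/2) r^3 f', a product in r and f' only, so the
  induction closes without treating root and inverse separately. Gram-Schmidt needs it for the
  normalization.\<close>

lemma Ck_on_rsqrt:
  fixes f :: "'a::euclidean_space \<Rightarrow> real"
  assumes pos: "\<And>x. f x > 0"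
  shows "Ck_on k UNIV f \<Longrightarrow> Ck_on k UNIV (\<lambda>x. inverse (sqrt (f x)))"
proof (induction k)
  case 0 then show ?case using pos
    by (auto intro!: continuous_intros simp: less_imp_neq[OF pos, symmetric])
next
  case (Suc k)
  let ?r = "\<lambda>x. inverse (sqrt (f x))"
  have h: "(?r has_derivative (\<lambda>v. (-(1/2) * (?r x * (?r x * ?r x))) * dd f v x)) (at x)" for x
  proof -
    have "((\<lambda>y. inverse (sqrt y)) has_real_derivative - (1/2) * (?r x * (?r x * ?r x))) (at (f x))"
      using pos[of x] by (auto intro!: derivative_eq_intros simp: field_simps)
    then show ?thesis
      using Suc.prems has_derivative_compose[OF differentiable_has_dd] 
      unfolding Ck_on_Suc_UNIV has_field_derivative_def by blast
  qed
  have d: "dd ?r v = (\<lambda>x. (-(1/2) * (?r x * (?r x * ?r x))) * dd f v x)" for v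
    using h by (rule dd_eqI)
  have r: "Ck_on k UNIV ?r" "\<And>v. Ck_on k UNIV (dd f v)"
    using Suc.prems Suc.IH[OF Ck_on_Suc_imp[OF Suc.prems]] unfolding Ck_on_Suc_UNIV by auto
  have "Ck_on k UNIV (dd ?r v)" for v
    unfolding d by (intro Ck_on_bilinear[OF bounded_bilinear_mult] Ck_on_const r)
  moreover have "?r differentiable (at x)" for x using h unfolding differentiable_def by blast
  ultimately show ?case unfolding Ck_on_Suc_UNIV by blast
qed

abbreviation smooth :: "('a::euclidean_space \<Rightarrow> 'b::euclidean_space) \<Rightarrow> bool" where
  "smooth f \<equiv> smooth_on UNIV f"

lemma smooth_differentiable: "smooth f \<Longrightarrow> f differentiable (at x)"
  unfolding smooth_on_def using Ck_on_Suc_UNIV[of 0 f] by blast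

lemma smooth_dd: "smooth f \<Longrightarrow> smooth (dd f v)"
  unfolding smooth_on_def using Ck_on_Suc_UNIV by blast

lemma smooth_has_derivative: "smooth f \<Longrightarrow> (f has_derivative (\<lambda>v. dd f v x)) (at x)"
  by (simp add: differentiable_has_dd smooth_differentiable)

lemma smooth_continuous: "smooth f \<Longrightarrow> continuous_on S f"
  unfolding smooth_on_def using Ck_on.simps(1) continuous_on_subset by blast

lemma smooth_const: "smooth (\<lambda>x. c)" and
  smooth_add: "smooth f \<Longrightarrow> smooth g \<Longrightarrow> smooth (\<lambda>x. f x + g x)" and
  smooth_scaleR: "smooth r \<Longrightarrow> smooth f \<Longrightarrow> smooth (\<lambda>x. r x *\<^sub>R f x)" and
  smooth_inner: "smooth f \<Longrightarrow> smooth g \<Longrightarrow> smooth (\<lambda>x. f x \<bullet> g x)"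
  unfolding smooth_on_def
  by (auto intro: Ck_on_const Ck_on_add Ck_on_bilinear[OF bounded_bilinear_scaleR]
      Ck_on_bilinear[OF bounded_bilinear_inner])

lemma smooth_diff:
  assumes "smooth f" "smooth g" shows "smooth (\<lambda>x. f x - g x)"
  using smooth_add[OF assms(1) smooth_scaleR[OF smooth_const[of "-1"] assms(2)]] by simp

lemma smooth_rsqrt: "(\<And>x. f x > 0) \<Longrightarrow> smooth f \<Longrightarrow> smooth (\<lambda>x. inverse (sqrt (f x)))"
  unfolding smooth_on_def by (blast intro: Ck_on_rsqrt)

lemma smooth_sum: "(\<And>i. i \<in> I \<Longrightarrow> smooth (f i)) \<Longrightarrow> smooth (\<lambda>x. \<Sum>i\<in>I. f i x)"
  by (induction I rule: infinite_finite_induct) (auto intro: smooth_const smooth_add)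

lemma linear_dd: "smooth f \<Longrightarrow> linear (\<lambda>v. dd f v x)"
  using smooth_has_derivative has_derivative_linear by blast

lemma dd_add: "smooth f \<Longrightarrow> dd f (v + w) x = dd f v x + dd f w x" and
  dd_diff: "smooth f \<Longrightarrow> dd f (v - w) x = dd f v x - dd f w x" and
  dd_scaleR: "smooth f \<Longrightarrow> dd f (r *\<^sub>R v) x = r *\<^sub>R dd f v x" and
  dd_zero: "smooth f \<Longrightarrow> dd f 0 x = 0"
  using linear_add[OF linear_dd[of f x], of v w] linear_diff[OF linear_dd[of f x], of v w]
    linear_scale[OF linear_dd[of f x], of r v] linear_0[OF linear_dd[of f x]] by simp_all

lemma dd_sum: "smooth f \<Longrightarrow> dd f (\<Sum>i\<in>I. v i) x = (\<Sum>i\<in>I. dd f (v i) x)"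
  using linear_sum[OF linear_dd] .

section \<open>Derivatives along lines and symmetry of second derivatives\<close>

lemma has_vector_derivative_along_line:
  assumes "smooth f"
  shows "((\<lambda>t. f (x + t *\<^sub>R v)) has_vector_derivative dd f v (x + t *\<^sub>R v)) (at t)"
proof -
  have "((\<lambda>t. x + t *\<^sub>R v) has_derivative (\<lambda>s. s *\<^sub>R v)) (at t)"
    by (auto intro!: derivative_eq_intros)
  from has_derivative_compose[OF this smooth_has_derivative[OF assms]]
  show ?thesis unfolding has_vector_derivative_def by (simp add: dd_scaleR[OF assms])
qed

lemma dd_inner_const: "smooth f \<Longrightarrow> dd (\<lambda>x. f x \<bullet> b) v = (\<lambda>x. dd f v x \<bullet> b)"
  by (rule dd_eqI[where f'="\<lambda>x v. dd f v x \<bullet> b"])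
    (auto intro!: derivative_eq_intros smooth_has_derivative)

text \<open>The mean value theorem, applied once in each direction. The second difference is
  symmetric in \<open>v\<close> and \<open>w\<close>, so comparing the two versions for small
  \<open>h\<close> gives the symmetry of second derivatives.\<close>

lemma smooth_second_difference:
  fixes f :: "'a::euclidean_space \<Rightarrow> real"
  assumes f: "smooth f" and h: "h > 0"
  shows "\<exists>s t. 0 < s \<and> s < h \<and> 0 < t \<and> t < h \<and>
    f (x + h *\<^sub>R v + h *\<^sub>R w) - f (x + h *\<^sub>R v) - f (x + h *\<^sub>R w) + f x
      = h * h * dd (dd f v) w (x + s *\<^sub>R v + t *\<^sub>R w)"
proof -
  define G where "G s = f ((x + h *\<^sub>R w) + s *\<^sub>R v) - f (x + s *\<^sub>R v)" for s
  have G: "(G has_real_derivative (dd f v ((x + h *\<^sub>R w) + s *\<^sub>R v) - dd f v (x + s *\<^sub>R v))) (at s)" for s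
    unfolding G_def has_real_derivative_iff_has_vector_derivative
    by (intro has_vector_derivative_diff has_vector_derivative_along_line f)
  obtain s where s: "0 < s" "s < h"
    "G h - G 0 = (h - 0) * (dd f v ((x + h *\<^sub>R w) + s *\<^sub>R v) - dd f v (x + s *\<^sub>R v))"
    using MVT2[OF h G] by blast
  define K where "K t = dd f v ((x + s *\<^sub>R v) + t *\<^sub>R w)" for t
  have K: "(K has_real_derivative dd (dd f v) w ((x + s *\<^sub>R v) + t *\<^sub>R w)) (at t)" for t
    unfolding K_def has_real_derivative_iff_has_vector_derivative
    by (intro has_vector_derivative_along_line smooth_dd f)
  obtain t where t: "0 < t" "t < h"
    "K h - K 0 = (h - 0) * dd (dd f v) w ((x + s *\<^sub>R v) + t *\<^sub>R w)"
    using MVT2[OF h K] by blast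
  have "G h - G 0 = h * (K h - K 0)" using s(3) by (simp add: K_def algebra_simps)
  also have "\<dots> = h * h * dd (dd f v) w ((x + s *\<^sub>R v) + t *\<^sub>R w)" using t(3) by simp
  finally show ?thesis using s t by (intro exI[of _ s] exI[of _ t]) (simp add: G_def algebra_simps)
qed

lemma dd_commute_real:
  fixes f :: "'a::euclidean_space \<Rightarrow> real"
  assumes f: "smooth f"
  shows "dd (dd f v) w x = dd (dd f w) v x"
proof -
  have lim: "\<forall>e>0. \<exists>d>0. \<forall>s t. 0 < s \<and> s < d \<and> 0 < t \<and> t < d \<longrightarrow> \<bar>g (x + s *\<^sub>R a + t *\<^sub>R b) - g x\<bar> < e"
    if g: "smooth g" for g :: "'a \<Rightarrow> real" and a b
  proof safe
    fix e :: real assume "e > 0"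
    have "isCont g x" using smooth_continuous[OF g, of UNIV] continuous_on_eq_continuous_at by blast
    then obtain d where d: "d > 0" "\<And>y. dist y x < d \<Longrightarrow> dist (g y) (g x) < e"
      using \<open>e > 0\<close> by (metis continuous_at_eps_delta)
    define d' where "d' = d / (norm a + norm b + 1)"
    have d': "d' > 0" using d by (simp add: d'_def add_nonneg_pos)
    have "\<bar>g (x + s *\<^sub>R a + t *\<^sub>R b) - g x\<bar> < e" if "0 < s" "s < d'" "0 < t" "t < d'" for s t
    proof -
      have "norm (s *\<^sub>R a + t *\<^sub>R b) \<le> s * norm a + t * norm b"
        using norm_triangle_ineq[of "s *\<^sub>R a" "t *\<^sub>R b"] that by simp
      also have "\<dots> \<le> d' * norm a + d' * norm b" using that by (intro add_mono mult_right_mono) auto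
      also have "\<dots> < d' * (norm a + norm b + 1)" using d' by (simp add: algebra_simps)
      also have "\<dots> = d" unfolding d'_def by (simp add: add_nonneg_eq_0_iff add_eq_0_iff_both_eq_0 add_nonneg_pos less_imp_neq[symmetric, of 0])
      finally show ?thesis using d(2)[of "x + s *\<^sub>R a + t *\<^sub>R b"] by (simp add: dist_norm add.assoc)
    qed
    then show "\<exists>d>0. \<forall>s t. 0 < s \<and> s < d \<and> 0 < t \<and> t < d \<longrightarrow> \<bar>g (x + s *\<^sub>R a + t *\<^sub>R b) - g x\<bar> < e"
      using d' by blast
  qed
  have "\<bar>dd (dd f v) w x - dd (dd f w) v x\<bar> \<le> 0"
  proof (rule field_le_epsilon)
    fix e :: real assume e: "e > 0"
    obtain d1 where d1: "d1 > 0" "\<And>s t. 0 < s \<Longrightarrow> s < d1 \<Longrightarrow> 0 < t \<Longrightarrow> t < d1 \<Longrightarrow>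
      \<bar>dd (dd f v) w (x + s *\<^sub>R v + t *\<^sub>R w) - dd (dd f v) w x\<bar> < e / 2"
      using lim[OF smooth_dd[OF smooth_dd[OF f]]] half_gt_zero[OF e] by meson
    obtain d2 where d2: "d2 > 0" "\<And>s t. 0 < s \<Longrightarrow> s < d2 \<Longrightarrow> 0 < t \<Longrightarrow> t < d2 \<Longrightarrow>
      \<bar>dd (dd f w) v (x + s *\<^sub>R w + t *\<^sub>R v) - dd (dd f w) v x\<bar> < e / 2"
      using lim[OF smooth_dd[OF smooth_dd[OF f]]] half_gt_zero[OF e] by meson
    define h where "h = min d1 d2"
    have h: "h > 0" "h \<le> d1" "h \<le> d2" using d1 d2 by (auto simp: h_def)
    obtain s t where st: "0 < s" "s < h" "0 < t" "t < h"
      "f (x + h *\<^sub>R v + h *\<^sub>R w) - f (x + h *\<^sub>R v) - f (x + h *\<^sub>R w) + f x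
      = h * h * dd (dd f v) w (x + s *\<^sub>R v + t *\<^sub>R w)"
      using smooth_second_difference[OF f h(1)] by blast
    obtain s' t' where st': "0 < s'" "s' < h" "0 < t'" "t' < h"
      "f (x + h *\<^sub>R w + h *\<^sub>R v) - f (x + h *\<^sub>R w) - f (x + h *\<^sub>R v) + f x
      = h * h * dd (dd f w) v (x + s' *\<^sub>R w + t' *\<^sub>R v)"
      using smooth_second_difference[OF f h(1)] by blast
    have "h * h * dd (dd f v) w (x + s *\<^sub>R v + t *\<^sub>R w) = h * h * dd (dd f w) v (x + s' *\<^sub>R w + t' *\<^sub>R v)"
      using st(5) st'(5) by (simp add: algebra_simps)
    then have "dd (dd f v) w (x + s *\<^sub>R v + t *\<^sub>R w) = dd (dd f w) v (x + s' *\<^sub>R w + t' *\<^sub>R v)"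
      using h by simp
    with d1(2)[of s t] d2(2)[of s' t'] st st' h
    show "\<bar>dd (dd f v) w x - dd (dd f w) v x\<bar> \<le> 0 + e" by linarith
  qed
  then show ?thesis by simp
qed

lemma dd_commute:
  assumes f: "smooth f"
  shows "dd (dd f v) w = dd (dd f w) v"
proof (rule ext, rule euclidean_eqI)
  fix x b
  have s: "smooth (\<lambda>x. f x \<bullet> b)" using smooth_inner[OF f smooth_const] .
  show "dd (dd f v) w x \<bullet> b = dd (dd f w) v x \<bullet> b"
    using dd_commute_real[OF s, of v w x] by (simp add: dd_inner_const f smooth_dd)
qed

section \<open>Spacelike graphs and their mean curvature\<close>

lemma dd_fun_add: "smooth f \<Longrightarrow> smooth g \<Longrightarrow> dd (\<lambda>x. f x + g x) v = (\<lambda>x. dd f v x + dd g v x)"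
  by (intro dd_eqI[where f'="\<lambda>x v. dd f v x + dd g v x"] has_derivative_add smooth_has_derivative)

lemma dd_fun_scaleR: "smooth f \<Longrightarrow> dd (\<lambda>x. r *\<^sub>R f x) v = (\<lambda>x. r *\<^sub>R dd f v x)"
  by (intro dd_eqI[where f'="\<lambda>x v. r *\<^sub>R dd f v x"] has_derivative_scaleR_right smooth_has_derivative)

lemma linear_dd_dd:
  assumes "smooth f" shows "linear (\<lambda>w. dd (dd f w) v x)"
proof (rule linearI)
  fix a b and r :: real
  have "dd f (a + b) = (\<lambda>x. dd f a x + dd f b x)" using assms by (auto simp: dd_add)
  then show "dd (dd f (a + b)) v x = dd (dd f a) v x + dd (dd f b) v x"
    by (simp add: dd_fun_add smooth_dd assms)
  have "dd f (r *\<^sub>R a) = (\<lambda>x. r *\<^sub>R dd f a x)" using assms by (auto simp: dd_scaleR)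
  then show "dd (dd f (r *\<^sub>R a)) v x = r *\<^sub>R dd (dd f a) v x"
    by (simp add: dd_fun_scaleR smooth_dd assms)
qed

lemma smooth_dd_along:
  assumes "smooth f" "smooth y" shows "smooth (\<lambda>x. dd f (y x) x)"
proof -
  have "dd f (y x) x = (\<Sum>b\<in>Basis. (y x \<bullet> b) *\<^sub>R dd f b x)" for x
    using dd_sum[OF assms(1), of "\<lambda>b. (y x \<bullet> b) *\<^sub>R b" Basis x]
    by (simp add: euclidean_representation dd_scaleR[OF assms(1)])
  then show ?thesis
    by (simp add: smooth_sum smooth_scaleR smooth_inner smooth_const smooth_dd assms)
qed

text \<open>A product rule that asks for derivatives of \<open>T\<close> at fixed arguments only.
  Expanding the argument in \<open>Basis\<close> leaves finitely many products of scalars and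
  vectors; uniqueness of derivatives makes \<open>T'\<close> linear in its first argument, so the
  expansion folds back.\<close>

lemma has_derivative_linear_family:
  fixes T :: "'a::euclidean_space \<Rightarrow> 'b::euclidean_space \<Rightarrow> 'c::euclidean_space"
  assumes lin: "\<And>y. linear (T y)"
    and T: "\<And>b. ((\<lambda>y. T y b) has_derivative T' b) (at x)"
    and f: "(f has_derivative f') (at x)"
  shows "((\<lambda>y. T y (f y)) has_derivative (\<lambda>v. T' (f x) v + T x (f' v))) (at x)"
proof -
  have lin': "linear (\<lambda>b. T' b v)" for v
  proof (rule linearI)
    fix a b and r :: real
    have "((\<lambda>y. T y (a + b)) has_derivative (\<lambda>v. T' a v + T' b v)) (at x)"
      unfolding linear_add[OF lin] by (intro has_derivative_add T)
    then show "T' (a + b) v = T' a v + T' b v" using has_derivative_unique[OF T] by metis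
    have "((\<lambda>y. T y (r *\<^sub>R a)) has_derivative (\<lambda>v. r *\<^sub>R T' a v)) (at x)"
      unfolding linear_scale[OF lin] by (intro has_derivative_scaleR_right T)
    then show "T' (r *\<^sub>R a) v = r *\<^sub>R T' a v" using has_derivative_unique[OF T] by metis
  qed
  have ex: "L z = (\<Sum>b\<in>Basis. (z \<bullet> b) *\<^sub>R L b)" if "linear L" for L :: "'b \<Rightarrow> 'c" and z
    using linear_sum[OF that, of "\<lambda>b. (z \<bullet> b) *\<^sub>R b" Basis]
    by (simp add: euclidean_representation linear_scale[OF that])
  have "((\<lambda>y. \<Sum>b\<in>Basis. (f y \<bullet> b) *\<^sub>R T y b) has_derivative
      (\<lambda>v. \<Sum>b\<in>Basis. (f x \<bullet> b) *\<^sub>R T' b v + (f' v \<bullet> b) *\<^sub>R T x b)) (at x)"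
    by (intro has_derivative_sum has_derivative_scaleR has_derivative_inner_left T f)
  then show ?thesis
    by (simp add: sum.distrib flip: ex[OF lin] ex[OF lin'])
qed

lemma has_derivative_dd_along:
  assumes "smooth f" and "y differentiable (at x)"
  shows "((\<lambda>x. dd f (y x) x) has_derivative (\<lambda>v. dd (dd f (y x)) v x + dd f (dd y v x) x)) (at x)"
  by (rule has_derivative_linear_family[where T="\<lambda>x b. dd f b x" and T'="\<lambda>b v. dd (dd f b) v x"])
    (intro linear_dd smooth_has_derivative smooth_dd differentiable_has_dd assms)+

text \<open>Symmetry of second derivatives merges the two terms in which a direction is
  differentiated and moves \<open>v\<close> innermost in the third derivative, so that the result
  speaks about \<open>dd f v\<close>, the linearized unknown.\<close>

lemma has_derivative_dd_dd_along:
  assumes f: "smooth f" and y: "y differentiable (at x)"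
  shows "((\<lambda>x. dd (dd f (y x)) (y x) x) has_derivative
    (\<lambda>v. dd (dd (dd f v) (y x)) (y x) x + 2 *\<^sub>R dd (dd f (y x)) (dd y v x) x)) (at x)"
proof -
  have "((\<lambda>z. dd (dd f (y z)) (y z) z) has_derivative
      (\<lambda>v. (dd (dd (dd f (y x)) (y x)) v x + dd (dd f (y x)) (dd y v x) x) + dd (dd f (dd y v x)) (y x) x)) (at x)"
  proof (rule has_derivative_linear_family[where T="\<lambda>x b. dd (dd f b) (y x) x"
        and T'="\<lambda>b v. dd (dd (dd f b) (y x)) v x + dd (dd f b) (dd y v x) x"])
    show "linear (\<lambda>b. dd (dd f b) (y z) z)" for z by (rule linear_dd_dd[OF f])
    show "((\<lambda>z. dd (dd f b) (y z) z) has_derivative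
        (\<lambda>v. dd (dd (dd f b) (y x)) v x + dd (dd f b) (dd y v x) x)) (at x)" for b
      by (intro has_derivative_dd_along smooth_dd f y)
    show "(y has_derivative (\<lambda>v. dd y v x)) (at x)" by (rule differentiable_has_dd[OF y])
  qed
  then show ?thesis
  proof (rule has_derivative_eq_rhs, intro ext)
    fix v
    have "dd (dd (dd f (y x)) (y x)) v = dd (dd (dd f v) (y x)) (y x)"
      using dd_commute[OF smooth_dd[OF f], of "y x" "y x" v] dd_commute[OF f, of "y x" v] by simp
    moreover have "dd (dd f (dd y v x)) (y x) = dd (dd f (y x)) (dd y v x)"
      by (rule dd_commute[OF f])
    ultimately show "(dd (dd (dd f (y x)) (y x)) v x + dd (dd f (y x)) (dd y v x) x) + dd (dd f (dd y v x)) (y x) x =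
        dd (dd (dd f v) (y x)) (y x) x + 2 *\<^sub>R dd (dd f (y x)) (dd y v x) x"
      by (simp add: scaleR_2)
  qed
qed

section \<open>Graphs in the pseudo-Euclidean space and their induced metric\<close>

lemma pseudo_inner_alt: "pseudo_inner a b = fst a \<bullet> fst b - snd a \<bullet> snd b"
  by (simp add: pseudo_inner_def inner_vec_def)

lemma push_graph_immersion:
  assumes "smooth u"
  shows "push (graph_immersion u) x v = (v, dd u v x)"
proof -
  have "(graph_immersion u has_derivative (\<lambda>v. (v, dd u v x))) (at x)"
    unfolding graph_immersion_def[abs_def]
    by (intro has_derivative_Pair has_derivative_ident smooth_has_derivative assms)
  then have "frechet_derivative (graph_immersion u) (at x) = (\<lambda>v. (v, dd u v x))"
    by (rule frechet_derivative_at[symmetric])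
  then show ?thesis by (simp add: push_def)
qed

locale spacelike_graph =
  fixes u :: "real^'m \<Rightarrow> real^'n"
  assumes smooth_u: "smooth u"
    and spacelike_u: "v \<noteq> 0 \<Longrightarrow> dd u v x \<bullet> dd u v x < v \<bullet> v"
begin

abbreviation X where "X \<equiv> graph_immersion u"

abbreviation zz :: "real^'m \<Rightarrow> real" where "zz x \<equiv> x \<bullet> x - u x \<bullet> u x"

definition g :: "real^'m \<Rightarrow> real^'m \<Rightarrow> real^'m \<Rightarrow> real" where
  "g x v w = v \<bullet> w - dd u v x \<bullet> dd u w x"

lemma g_sym: "g x v w = g x w v"
  by (simp add: g_def inner_commute)

lemma linear_g: "linear (g x v)"
  by (rule linearI) (simp_all add: g_def dd_add dd_scaleR smooth_u algebra_simps inner_add)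

lemma g_diff_right: "g x v (w - w') = g x v w - g x v w'"
  and g_scaleR_right: "g x v (r *\<^sub>R w) = r * g x v w"
  and g_sum_right: "g x v (\<Sum>i\<in>I. f i) = (\<Sum>i\<in>I. g x v (f i))"
  using linear_diff[OF linear_g] linear_scale[OF linear_g] linear_sum[OF linear_g]
  by auto

lemma g_diff_left: "g x (w - w') v = g x w v - g x w' v"
  and g_scaleR_left: "g x (r *\<^sub>R w) v = r * g x w v"
  and g_sum_left: "g x (\<Sum>i\<in>I. f i) v = (\<Sum>i\<in>I. g x (f i) v)"
  by (simp_all add: g_sym[of x _ v] g_diff_right g_scaleR_right g_sum_right)

lemma g_pos: "v \<noteq> 0 \<Longrightarrow> g x v v > 0"
  using spacelike_u by (simp add: g_def)

lemma g_nonneg: "g x v v \<ge> 0"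
  using g_pos[of v x] linear_0[OF linear_g, of x 0] by (cases "v = 0") auto

lemma smooth_g: "smooth f \<Longrightarrow> smooth h \<Longrightarrow> smooth (\<lambda>x. g x (f x) (h x))"
  unfolding g_def by (intro smooth_diff smooth_inner smooth_dd_along smooth_u)

section \<open>Orthonormal frames of the induced metric\<close>

definition orthonormal :: "real^'m \<Rightarrow> ('m \<Rightarrow> real^'m) \<Rightarrow> bool" where
  "orthonormal x c \<longleftrightarrow> (\<forall>i j. g x (c i) (c j) = (if i = j then 1 else 0))"

text \<open>Pairing with the frame recovers the coefficients of a combination, so the coefficient
  map is injective; being an endomorphism of \<open>real^'m\<close>, it is also surjective.\<close>

lemma orthonormal_expansion:
  assumes "orthonormal x c"
  shows "(\<Sum>i\<in>UNIV. g x v (c i) *\<^sub>R c i) = v"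
proof -
  define \<Gamma> where "\<Gamma> y = (\<Sum>i\<in>UNIV. (y $ i) *\<^sub>R c i)" for y :: "real^'m"
  have lin: "linear \<Gamma>"
    by (rule linearI) (simp_all add: \<Gamma>_def scaleR_add_left sum.distrib scaleR_sum_right)
  have coeff: "g x (\<Gamma> y) (c i) = y $ i" for y i
  proof -
    have "g x (c j) (c i) = (if j = i then 1 else 0)" for j using assms by (simp add: orthonormal_def)
    then show ?thesis
      by (simp add: \<Gamma>_def g_sum_left g_scaleR_left if_distrib[of "\<lambda>r. _ * r"] cong: if_cong)
  qed
  have "inj \<Gamma>"
    using coeff by (metis injI vec_eq_iff)
  then obtain y where "v = \<Gamma> y"
    using linear_injective_imp_surjective[OF lin] by (auto elim: surjE)
  then show ?thesis using coeff by (simp add: \<Gamma>_def)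
qed

lemma orthonormal_Parseval:
  assumes "orthonormal x c"
  shows "(\<Sum>i\<in>UNIV. g x v (c i) * g x w (c i)) = g x v w"
proof -
  have "g x v w = g x v (\<Sum>i\<in>UNIV. g x w (c i) *\<^sub>R c i)"
    by (simp add: orthonormal_expansion[OF assms])
  then show ?thesis by (simp add: g_sum_right g_scaleR_right mult.commute)
qed

text \<open>The transition matrix between two orthonormal frames is orthogonal, which is Parseval's
  identity for the second frame expanded in the first. Vector values of \<open>B\<close> allow it to
  be used for second derivatives of \<open>u\<close>.\<close>

lemma trace_frame_independent:
  fixes B :: "real^'m \<Rightarrow> real^'m \<Rightarrow> 'b::real_vector"
  assumes "\<And>v. linear (B v)" "\<And>w. linear (\<lambda>v. B v w)"
    and c: "orthonormal x c" and d: "orthonormal x d"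
  shows "(\<Sum>i\<in>UNIV. B (c i) (c i)) = (\<Sum>i\<in>UNIV. B (d i) (d i))"
proof -
  have ex: "B v w = (\<Sum>j\<in>UNIV. \<Sum>k\<in>UNIV. (g x v (d j) * g x w (d k)) *\<^sub>R B (d j) (d k))" for v w
  proof -
    have "B v w = B (\<Sum>j\<in>UNIV. g x v (d j) *\<^sub>R d j) (\<Sum>k\<in>UNIV. g x w (d k) *\<^sub>R d k)"
      by (simp add: orthonormal_expansion[OF d])
    then show ?thesis
      by (simp add: linear_sum[OF assms(1)] linear_sum[OF assms(2)] linear_scale[OF assms(1)]
          linear_scale[OF assms(2)] scaleR_sum_right) (subst sum.swap, simp add: mult.commute)
  qed
  have "(\<Sum>i\<in>UNIV. B (c i) (c i)) =
      (\<Sum>i\<in>UNIV. \<Sum>j\<in>UNIV. \<Sum>k\<in>UNIV. (g x (c i) (d j) * g x (c i) (d k)) *\<^sub>R B (d j) (d k))"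
    by (rule sum.cong[OF refl]) (rule ex)
  also have "\<dots> = (\<Sum>j\<in>UNIV. \<Sum>i\<in>UNIV. \<Sum>k\<in>UNIV. (g x (c i) (d j) * g x (c i) (d k)) *\<^sub>R B (d j) (d k))"
    by (rule sum.swap)
  also have "\<dots> = (\<Sum>j\<in>UNIV. \<Sum>k\<in>UNIV. (\<Sum>i\<in>UNIV. g x (c i) (d j) * g x (c i) (d k)) *\<^sub>R B (d j) (d k))"
    by (rule sum.cong[OF refl], subst sum.swap) (simp add: scaleR_sum_left)
  also have "\<dots> = (\<Sum>j\<in>UNIV. \<Sum>k\<in>UNIV. (if j = k then 1 else 0) *\<^sub>R B (d j) (d k))"
  proof -
    have "(\<Sum>i\<in>UNIV. g x (c i) (d j) * g x (c i) (d k)) = (if j = k then 1 else 0)" for j k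
      using orthonormal_Parseval[OF c, of "d j" "d k"] d
      by (simp add: orthonormal_def g_sym[of x "c i" for i])
    then show ?thesis by simp
  qed
  also have "\<dots> = (\<Sum>i\<in>UNIV. B (d i) (d i))"
    by (simp add: if_distrib[of "\<lambda>r. r *\<^sub>R _"] cong: if_cong)
  finally show ?thesis .
qed

text \<open>Gram-Schmidt applied to the coordinate vectors; the single chart of a graph makes the
  frame global. The induction carries the extra clause that the vectors built so far have no
  components outside \<open>I\<close>.\<close>

lemma smooth_orthonormal_frame:
  "\<exists>e. (\<forall>i. smooth (e i)) \<and> (\<forall>x. orthonormal x (\<lambda>i. e i x))"
proof -
  have "\<exists>e :: 'm \<Rightarrow> real^'m \<Rightarrow> real^'m. (\<forall>i\<in>I. smooth (e i)) \<and>
      (\<forall>x. \<forall>i\<in>I. \<forall>j\<in>I. g x (e i x) (e j x) = (if i = j then 1 else 0)) \<and>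
      (\<forall>x. \<forall>i\<in>I. \<forall>k. k \<notin> I \<longrightarrow> e i x $ k = 0)" for I
  proof (induction I rule: finite_induct[OF finite])
    case (2 k I)
    then obtain e where e: "\<And>i. i \<in> I \<Longrightarrow> smooth (e i)"
      "\<And>x i j. i \<in> I \<Longrightarrow> j \<in> I \<Longrightarrow> g x (e i x) (e j x) = (if i = j then 1 else 0)"
      "\<And>x i l. i \<in> I \<Longrightarrow> l \<notin> I \<Longrightarrow> e i x $ l = 0" by metis
    define a :: "real^'m" where "a = axis k 1"
    define r where "r x = a - (\<Sum>i\<in>I. g x a (e i x) *\<^sub>R e i x)" for x
    \<comment> \<open>The support clause pays off here: component \<open>k\<close> of the remainder
      is 1 at every point, so the remainder never vanishes and can be normalized smoothly.\<close>
    have r0: "r x $ l = (if l = k then 1 else 0)" if "l \<notin> I" for x l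
      using that e(3) by (simp add: r_def a_def axis_def)
    then have rpos: "g x (r x) (r x) > 0" for x
      using 2(2) by (intro g_pos) (metis zero_index zero_neq_one)
    have sr: "smooth r"
      unfolding r_def by (intro smooth_diff smooth_sum smooth_scaleR smooth_g smooth_const e)
    have re: "g x (r x) (e j x) = 0" if "j \<in> I" for x j
    proof -
      have "(\<Sum>i\<in>I. g x a (e i x) * g x (e i x) (e j x)) = (\<Sum>i\<in>I. if i = j then g x a (e i x) else 0)"
        using that e(2) by (intro sum.cong) auto
      then show ?thesis using that 2(1) by (simp add: r_def g_diff_left g_sum_left g_scaleR_left)
    qed
    define q where "q x = inverse (sqrt (g x (r x) (r x)))" for x
    have q: "smooth q" unfolding q_def by (intro smooth_rsqrt rpos smooth_g sr)
    have qq: "q x * q x * g x (r x) (r x) = 1" for x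
      using rpos[of x] by (simp add: q_def field_simps)
    define e' where "e' i x = (if i = k then q x *\<^sub>R r x else e i x)" for i x
    have "smooth (e' i)" if "i \<in> insert k I" for i
      using that e(1) smooth_scaleR[OF q sr] by (cases "i = k") (auto simp: e'_def[abs_def])
    moreover have "g x (e' i x) (e' j x) = (if i = j then 1 else 0)"
      if "i \<in> insert k I" "j \<in> insert k I" for x i j
    proof -
      have "g x (q x *\<^sub>R r x) (q x *\<^sub>R r x) = 1"
        using qq[of x] by (simp add: g_scaleR_left g_scaleR_right)
      moreover have "g x (q x *\<^sub>R r x) (e j x) = 0" "g x (e j x) (q x *\<^sub>R r x) = 0" if "j \<in> I" for j
        using re[OF that, of x] g_sym[of x "r x" "e j x"] by (simp_all add: g_scaleR_left g_scaleR_right)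
      ultimately show ?thesis using that e(2) 2(2) by (auto simp: e'_def)
    qed
    moreover have "e' i x $ l = 0" if "i \<in> insert k I" "l \<notin> insert k I" for x i l
      using that e(3) r0 by (auto simp: e'_def)
    ultimately show ?case by blast
  qed simp
  from this[of UNIV] show ?thesis by (simp add: orthonormal_def)
qed

lemma orthonormal_exists: "\<exists>c. orthonormal x c"
  using smooth_orthonormal_frame by blast

section \<open>Tangential and normal projection, second fundamental form and mean curvature\<close>

lemmas push_graph = push_graph_immersion[OF smooth_u]

lemma induced_metric_graph: "induced_metric X x v w = g x v w"
  by (simp add: induced_metric_def push_graph pseudo_inner_alt g_def)

lemma pseudo_inner_push: "pseudo_inner (push X x v) (push X x w) = g x v w"
  by (simp add: push_graph pseudo_inner_alt g_def)

lemma linear_push: "linear (push X x)"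
  by (rule linearI) (simp_all add: push_graph dd_add dd_scaleR smooth_u)

lemma pseudo_inner_diff_left: "pseudo_inner (a - b) c = pseudo_inner a c - pseudo_inner b c"
  and pseudo_inner_add_left: "pseudo_inner (a + b) c = pseudo_inner a c + pseudo_inner b c"
  and pseudo_inner_scaleR_left: "pseudo_inner (r *\<^sub>R a) c = r * pseudo_inner a c"
  and pseudo_inner_sum_right: "pseudo_inner a (\<Sum>i\<in>I. f i) = (\<Sum>i\<in>I. pseudo_inner a (f i))"
  and pseudo_inner_scaleR_right: "pseudo_inner a (r *\<^sub>R c) = r * pseudo_inner a c"
  by (simp_all add: pseudo_inner_alt inner_diff_left inner_add_left fst_sum snd_sum inner_sum_right
      sum_subtractf right_diff_distrib inner_commute[of "fst c"] inner_commute[of "snd c"])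

lemma normal_spaceI: "(\<And>v. pseudo_inner w (push X x v) = 0) \<Longrightarrow> w \<in> normal_space X x"
  by (auto simp: normal_space_def tangent_space_def)

text \<open>Two candidates differ by a vector that is both tangent and normal; positivity of
  \<open>g\<close> forces it to be 0. This settles the definite description once and for
  all.\<close>

lemma normal_partI:
  assumes w: "\<And>v. pseudo_inner w (push X x v) = 0" and t: "a - w = push X x t"
  shows "normal_part X x a = w"
  unfolding normal_part_def
proof (rule the_equality)
  show "w \<in> normal_space X x \<and> a - w \<in> tangent_space X x"
    using assms by (auto intro: normal_spaceI simp: tangent_space_def)
next
  fix w' assume w': "w' \<in> normal_space X x \<and> a - w' \<in> tangent_space X x"
  then obtain t' where t': "a - w' = push X x t'" by (auto simp: tangent_space_def)
  have "w' - w = push X x (t - t')" using t t' by (simp add: linear_diff[OF linear_push] algebra_simps)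
  moreover have "pseudo_inner (w' - w) (push X x (t - t')) = 0"
    using w w' by (simp add: normal_space_def tangent_space_def pseudo_inner_diff_left)
  ultimately have "g x (t - t') (t - t') = 0" by (simp add: pseudo_inner_push)
  then have "t - t' = 0" using g_pos[of "t - t'" x] by fastforce
  then have "t' = t" by simp
  with t t' have "a - w' = a - w" by simp
  then show "w' = w" by simp
qed

text \<open>The parameter vector whose push-forward is the tangential projection of
  \<open>a\<close>. The choice operator keeps it free of frames; \<open>tangent_coeff_eq\<close>
  computes it in any orthonormal frame.\<close>

definition tangent_coeff :: "real^'m \<Rightarrow> (real^'m) \<times> (real^'n) \<Rightarrow> real^'m" where
  "tangent_coeff x a = (SOME t. \<forall>v. pseudo_inner (a - push X x t) (push X x v) = 0)"

lemma tangent_coeff_eq: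
  assumes c: "orthonormal x c"
  shows "tangent_coeff x a = (\<Sum>i\<in>UNIV. pseudo_inner a (push X x (c i)) *\<^sub>R c i)" (is "_ = ?t")
    and "pseudo_inner (a - push X x (tangent_coeff x a)) (push X x v) = 0"
proof -
  have *: "pseudo_inner (a - push X x ?t) (push X x v) = 0" for v
  proof -
    have "push X x v = (\<Sum>i\<in>UNIV. g x v (c i) *\<^sub>R push X x (c i))"
      using linear_sum[OF linear_push, of x "\<lambda>i. g x v (c i) *\<^sub>R c i" UNIV]
      by (simp add: orthonormal_expansion[OF c] linear_scale[OF linear_push])
    then have "pseudo_inner a (push X x v) = (\<Sum>i\<in>UNIV. g x v (c i) * pseudo_inner a (push X x (c i)))"
      by (simp add: pseudo_inner_sum_right pseudo_inner_scaleR_right)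
    also have "\<dots> = g x ?t v"
      by (simp add: g_sum_left g_scaleR_left mult.commute g_sym[of x v])
    finally show ?thesis by (simp add: pseudo_inner_diff_left pseudo_inner_push)
  qed
  have "\<forall>v. pseudo_inner (a - push X x (tangent_coeff x a)) (push X x v) = 0"
    unfolding tangent_coeff_def by (rule someI[of _ ?t]) (use * in blast)
  then show 1: "pseudo_inner (a - push X x (tangent_coeff x a)) (push X x v) = 0" for v by blast
  have "g x (?t - tangent_coeff x a) v = 0" for v
    using 1[of v] *[of v] by (simp add: pseudo_inner_diff_left pseudo_inner_push g_diff_left)
  from this[of "?t - tangent_coeff x a"] have "?t - tangent_coeff x a = 0"
    using g_pos[of "?t - tangent_coeff x a" x] by fastforce
  then show "tangent_coeff x a = ?t" by simp
qed

lemma tangent_coeff_normal: "pseudo_inner (a - push X x (tangent_coeff x a)) (push X x v) = 0"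
  using tangent_coeff_eq(2) orthonormal_exists by blast

lemma normal_part_eq: "normal_part X x a = a - push X x (tangent_coeff x a)"
  by (rule normal_partI[OF tangent_coeff_normal]) simp

lemma linear_tangent_coeff: "linear (tangent_coeff x)"
proof -
  obtain c where c: "orthonormal x c" using orthonormal_exists by blast
  show ?thesis unfolding tangent_coeff_eq(1)[OF c]
    by (rule linearI) (simp_all add: pseudo_inner_add_left pseudo_inner_scaleR_left scaleR_add_left
        sum.distrib scaleR_sum_right)
qed

lemma tangent_coeff_push: "tangent_coeff x (push X x v) = v"
proof -
  obtain c where c: "orthonormal x c" using orthonormal_exists by blast
  show ?thesis unfolding tangent_coeff_eq(1)[OF c] pseudo_inner_push by (rule orthonormal_expansion[OF c])
qed

lemma linear_normal_part: "linear (normal_part X x)"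
  unfolding normal_part_eq[abs_def]
  by (intro linear_compose_sub linear_id[unfolded id_def] linear_compose[OF linear_tangent_coeff linear_push, unfolded o_def])

lemma normal_part_push: "normal_part X x (push X x v) = 0"
  by (simp add: normal_part_eq tangent_coeff_push)

text \<open>The flat derivative splits into (0, D^2 u (U, W)) and the push-forward of the derivative
  of \<open>W\<close>. The latter is tangent and disappears, so only the values of the fields at
  \<open>x\<close> matter.\<close>

lemma second_fundamental_form_graph:
  assumes "W differentiable (at x)"
  shows "second_fundamental_form X U W x = normal_part X x (0, dd (dd u (W x)) (U x) x)"
proof -
  have "((\<lambda>y. push X y (W y)) has_derivative
      (\<lambda>v. (dd W v x, dd (dd u (W x)) v x + dd u (dd W v x) x))) (at x)"
    unfolding push_graph
    by (intro has_derivative_Pair differentiable_has_dd assms has_derivative_dd_along smooth_u)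
  then have "frechet_derivative (\<lambda>y. push X y (W y)) (at x) =
      (\<lambda>v. (dd W v x, dd (dd u (W x)) v x + dd u (dd W v x) x))"
    by (rule frechet_derivative_at[symmetric])
  then have "frechet_derivative (\<lambda>y. push X y (W y)) (at x) (U x) =
     (dd W (U x) x, dd (dd u (W x)) (U x) x + dd u (dd W (U x) x) x)"
    by simp
  also have "\<dots> = (0, dd (dd u (W x)) (U x) x) + push X x (dd W (U x) x)"
    by (simp add: push_graph)
  finally show ?thesis
    by (simp add: second_fundamental_form_def linear_add[OF linear_normal_part] normal_part_push)
qed

text \<open>The trace g^{ij} u_ij, written over a chosen frame instead of an inverse matrix.\<close>

definition hess_trace :: "real^'m \<Rightarrow> real^'n" where
  "hess_trace x = (\<Sum>i\<in>UNIV. dd (dd u ((SOME c. orthonormal x c) i)) ((SOME c. orthonormal x c) i) x)"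

lemma hess_trace_eq:
  assumes "orthonormal x c"
  shows "hess_trace x = (\<Sum>i\<in>UNIV. dd (dd u (c i)) (c i) x)"
proof -
  have "orthonormal x (SOME c. orthonormal x c)" using orthonormal_exists by (rule someI_ex)
  then show ?thesis unfolding hess_trace_def
    using trace_frame_independent[of "\<lambda>v w. dd (dd u w) v x", OF linear_dd_dd[OF smooth_u]
        linear_dd[OF smooth_dd[OF smooth_u]] _ assms] by blast
qed

lemma mean_curvature_graph: "mean_curvature X x = normal_part X x (0, hess_trace x)"
  unfolding mean_curvature_def
proof (rule the_equality)
  have *: "(\<Sum>i\<in>UNIV. second_fundamental_form X (e i) (e i) x) = normal_part X x (0, hess_trace x)"
    if "x \<in> S" "local_orthonormal_frame X S e" for S e
  proof -
    have diff: "e i differentiable (at x)" for i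
      using that unfolding local_orthonormal_frame_def smooth_on_def
      by (meson Ck_on.simps(2)[THEN iffD1])
    have "orthonormal x (\<lambda>i. e i x)"
      using that by (simp add: local_orthonormal_frame_def orthonormal_def induced_metric_graph)
    then have h: "hess_trace x = (\<Sum>i\<in>UNIV. dd (dd u (e i x)) (e i x) x)" by (rule hess_trace_eq)
    have "(0, hess_trace x) = (\<Sum>i\<in>UNIV. (0 :: real^'m, dd (dd u (e i x)) (e i x) x))"
      unfolding h by (simp add: prod_eq_iff fst_sum snd_sum)
    then show ?thesis
      by (simp add: second_fundamental_form_graph[OF diff] linear_sum[OF linear_normal_part])
  qed
  obtain e where e: "\<And>i. smooth (e i)" "\<And>x. orthonormal x (\<lambda>i. e i x)"
    using smooth_orthonormal_frame by blast
  have "local_orthonormal_frame X UNIV e"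
    using e by (simp add: local_orthonormal_frame_def orthonormal_def induced_metric_graph)
  then show "\<exists>S e. x \<in> S \<and> local_orthonormal_frame X S e \<and>
      normal_part X x (0, hess_trace x) = (\<Sum>i\<in>UNIV. second_fundamental_form X (e i) (e i) x)"
    using *[OF UNIV_I] by (intro exI[of _ UNIV] exI[of _ e]) simp
  show "h = normal_part X x (0, hess_trace x)"
    if "\<exists>S e. x \<in> S \<and> local_orthonormal_frame X S e \<and>
        h = (\<Sum>i\<in>UNIV. second_fundamental_form X (e i) (e i) x)" for h
    using that * by blast
qed

text \<open>The equation says that (0, tr D^2 u) + X/2 is tangent. The first component of a
  push-forward is its parameter vector, which is therefore x/2; the second component is the
  claim.\<close>

lemma self_shrinker_graph_equation:
  assumes "self_shrinker X"
  shows "hess_trace x = (1/2) *\<^sub>R (dd u x x - u x)"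
proof -
  have "normal_part X x (0, hess_trace x) = - (1/2) *\<^sub>R normal_part X x (X x)"
    using assms by (simp add: self_shrinker_def mean_curvature_graph)
  then have "normal_part X x ((0, hess_trace x) + (1/2) *\<^sub>R X x) = 0"
    by (simp add: linear_add[OF linear_normal_part] linear_scale[OF linear_normal_part])
  then have "(0, hess_trace x) + (1/2) *\<^sub>R X x = push X x (tangent_coeff x ((0, hess_trace x) + (1/2) *\<^sub>R X x))"
    by (simp add: normal_part_eq)
  then obtain t where "(0, hess_trace x) + (1/2) *\<^sub>R X x = push X x t" by blast
  then have "t = (1/2) *\<^sub>R x" "hess_trace x + (1/2) *\<^sub>R u x = dd u t x"
    by (auto simp: push_graph graph_immersion_def)
  then show ?thesis by (simp add: dd_scaleR smooth_u algebra_simps)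
qed

end

section \<open>The linearized system and second derivative tests\<close>

text \<open>A positive \<open>f''\<close> would make \<open>f'\<close> positive just to the right of
  0, and the mean value theorem would lift \<open>f\<close> above \<open>f 0\<close>.
  Differentiability of \<open>f'\<close> is asked at 0 alone, in line with the one-point hypothesis
  on \<open>Q'\<close> later.\<close>

lemma second_derivative_at_max:
  fixes f :: "real \<Rightarrow> real"
  assumes f: "\<And>t. (f has_real_derivative f' t) (at t)"
    and f': "(f' has_real_derivative f'') (at 0)"
    and max: "\<And>t. f t \<le> f 0"
  shows "f' 0 = 0" "f'' \<le> 0"
proof -
  show 0: "f' 0 = 0"
    by (rule DERIV_local_max[OF f, of 1]) (use max in auto)
  show "f'' \<le> 0"
  proof (rule ccontr)
    assume "\<not> f'' \<le> 0"
    then obtain d where d: "d > 0" "\<And>h. 0 < h \<Longrightarrow> h < d \<Longrightarrow> f' 0 < f' (0 + h)"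
      using DERIV_pos_inc_right[OF f'] by auto
    obtain z where "0 < z" "z < d / 2" "f (d / 2) - f 0 = (d / 2 - 0) * f' z"
      using MVT2[of 0 "d / 2" f f'] d(1) f by auto
    moreover have "f' z > 0" using d(2)[of z] 0 \<open>0 < z\<close> \<open>z < d / 2\<close> d(1) by simp
    ultimately have "f (d / 2) > f 0" using d(1) by (smt (verit) mult_pos_pos half_gt_zero)
    then show False using max[of "d / 2"] by simp
  qed
qed

text \<open>Split off the rank one matrix with entries l a_i a_j / \<tau>. The rest \<open>B\<close>
  is orthogonal to it and has trace tr A - l; Cauchy-Schwarz on its diagonal gives the second term.
  Dividing by m rather than m - 1 includes m = 1.\<close>

lemma sum_squares_ge_eigenvalue_trace:
  fixes A :: "'m::finite \<Rightarrow> 'm \<Rightarrow> real"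
  assumes eig: "\<And>i. (\<Sum>j\<in>UNIV. A i j * a j) = l * a i"
    and \<tau>: "(\<Sum>i\<in>UNIV. (a i)\<^sup>2) = \<tau>" "\<tau> > 0"
  shows "l\<^sup>2 + ((\<Sum>i\<in>UNIV. A i i) - l)\<^sup>2 / real CARD('m) \<le> (\<Sum>i\<in>UNIV. \<Sum>j\<in>UNIV. (A i j)\<^sup>2)"
proof -
  define B where "B i j = A i j - l * a i * a j / \<tau>" for i j
  have sq: "(B i j)\<^sup>2 = (A i j)\<^sup>2 - (2 * l / \<tau>) * (a i * (A i j * a j)) + (l\<^sup>2 / \<tau>\<^sup>2) * ((a i)\<^sup>2 * (a j)\<^sup>2)" for i j
    unfolding B_def using \<tau>(2) by (simp add: field_simps power2_eq_square)
  have 1: "(\<Sum>i\<in>UNIV. \<Sum>j\<in>UNIV. a i * (A i j * a j)) = l * \<tau>"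
  proof -
    have "(\<Sum>i\<in>UNIV. \<Sum>j\<in>UNIV. a i * (A i j * a j)) = (\<Sum>i\<in>UNIV. l * (a i)\<^sup>2)"
      by (simp add: eig power2_eq_square mult.left_commute flip: sum_distrib_left)
    then show ?thesis using \<tau>(1) by (simp flip: sum_distrib_left)
  qed
  have 2: "(\<Sum>i\<in>UNIV. \<Sum>j\<in>UNIV. (a i)\<^sup>2 * (a j)\<^sup>2) = \<tau>\<^sup>2"
    using \<tau>(1) by (simp add: power2_eq_square[of \<tau>] flip: sum_distrib_left sum_distrib_right)
  have "(\<Sum>i\<in>UNIV. \<Sum>j\<in>UNIV. (B i j)\<^sup>2) = (\<Sum>i\<in>UNIV. \<Sum>j\<in>UNIV. (A i j)\<^sup>2)
      - (2 * l / \<tau>) * (l * \<tau>) + (l\<^sup>2 / \<tau>\<^sup>2) * \<tau>\<^sup>2"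
    unfolding sq 1[symmetric] 2[symmetric] by (simp add: sum.distrib sum_subtractf sum_distrib_left)
  also have "\<dots> = (\<Sum>i\<in>UNIV. \<Sum>j\<in>UNIV. (A i j)\<^sup>2) - l\<^sup>2"
    using \<tau>(2) by (simp add: field_simps power2_eq_square)
  finally have BB: "(\<Sum>i\<in>UNIV. \<Sum>j\<in>UNIV. (B i j)\<^sup>2) = (\<Sum>i\<in>UNIV. \<Sum>j\<in>UNIV. (A i j)\<^sup>2) - l\<^sup>2" .
  have "(\<Sum>i\<in>UNIV. B i i) = (\<Sum>i\<in>UNIV. A i i) - l * (\<Sum>i\<in>UNIV. (a i)\<^sup>2) / \<tau>"
    by (simp add: B_def sum_subtractf power2_eq_square sum_distrib_left sum_divide_distrib mult.assoc)
  then have trB: "(\<Sum>i\<in>UNIV. B i i) = (\<Sum>i\<in>UNIV. A i i) - l" using \<tau> by simp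
  have "(\<Sum>i\<in>UNIV. B i i)\<^sup>2 \<le> (\<Sum>i\<in>(UNIV::'m set). 1\<^sup>2) * (\<Sum>i\<in>UNIV. (B i i)\<^sup>2)"
    using Cauchy_Schwarz_ineq_sum[of "\<lambda>_. 1" "\<lambda>i. B i i" UNIV] by simp
  also have "\<dots> \<le> real CARD('m) * (\<Sum>i\<in>UNIV. \<Sum>j\<in>UNIV. (B i j)\<^sup>2)"
    by (auto intro!: mult_left_mono sum_mono member_le_sum)
  finally have "((\<Sum>i\<in>UNIV. A i i) - l)\<^sup>2 / real CARD('m) \<le> (\<Sum>i\<in>UNIV. \<Sum>j\<in>UNIV. (B i j)\<^sup>2)"
    by (simp add: trB field_simps)
  then show ?thesis using BB by simp
qed

locale graph_shrinker = spacelike_graph u for u :: "real^'m \<Rightarrow> real^'n" +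
  assumes shrinker: "hess_trace x = (1/2) *\<^sub>R (dd u x x - u x)"
    and u_0: "u 0 = 0"
begin

text \<open>The shrinker equation differentiated in the direction \<open>v\<close> along a smooth
  orthonormal frame. The two copies of Du v on the right-hand side cancel; the double sum plays the
  part of the derivative of the inverse metric.\<close>

lemma orthonormal_linearized_equation:
  "\<exists>c. orthonormal x c \<and> (\<forall>v.
     (\<Sum>i\<in>UNIV. dd (dd (dd u v) (c i)) (c i) x) = (1/2) *\<^sub>R dd (dd u x) v x
       - 2 *\<^sub>R (\<Sum>i\<in>UNIV. \<Sum>j\<in>UNIV. (dd (dd u v) (c i) x \<bullet> dd u (c j) x) *\<^sub>R dd (dd u (c i)) (c j) x))"
proof -
  obtain e where e: "\<And>i. smooth (e i)" "\<And>x. orthonormal x (\<lambda>i. e i x)"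
    using smooth_orthonormal_frame by blast
  note s = smooth_u smooth_dd[OF smooth_u]
  have "(\<Sum>i\<in>UNIV. dd (dd (dd u v) (e i x)) (e i x) x) = (1/2) *\<^sub>R dd (dd u x) v x
       - 2 *\<^sub>R (\<Sum>i\<in>UNIV. \<Sum>j\<in>UNIV. (dd (dd u v) (e i x) x \<bullet> dd u (e j x) x) *\<^sub>R dd (dd u (e i x)) (e j x) x)" for v
  proof -
    define U where "U i j = dd (dd u (e i x)) (e j x) x" for i j
    define M where "M i j = g x (dd (e i) v x) (e j x)" for i j
    define T where "T i j = dd (dd u v) (e i x) x \<bullet> dd u (e j x) x" for i j
    have U_sym: "U i j = U j i" for i j
      unfolding U_def using dd_commute[OF smooth_u, of "e i x" "e j x"] by simp
    have "((\<lambda>y. \<Sum>i\<in>UNIV. dd (dd u (e i y)) (e i y) y) has_derivative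
       (\<lambda>v. \<Sum>i\<in>UNIV. dd (dd (dd u v) (e i x)) (e i x) x + 2 *\<^sub>R dd (dd u (e i x)) (dd (e i) v x) x)) (at x)"
      by (intro has_derivative_sum has_derivative_dd_dd_along smooth_u smooth_differentiable e)
    moreover have "(\<Sum>i\<in>UNIV. dd (dd u (e i y)) (e i y) y) = (1/2) *\<^sub>R (dd u y y - u y)" for y
      using hess_trace_eq[OF e(2), of y] shrinker[of y] by simp
    moreover have "((\<lambda>y. (1/2) *\<^sub>R (dd u y y - u y)) has_derivative
       (\<lambda>v. (1/2) *\<^sub>R ((dd (dd u x) v x + dd u (dd (\<lambda>y. y) v x) x) - dd u v x))) (at x)"
      by (intro has_derivative_scaleR_right has_derivative_diff has_derivative_dd_along smooth_u
          smooth_has_derivative differentiable_ident)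
    ultimately have "(\<lambda>v. \<Sum>i\<in>UNIV. dd (dd (dd u v) (e i x)) (e i x) x + 2 *\<^sub>R dd (dd u (e i x)) (dd (e i) v x) x)
        = (\<lambda>v. (1/2) *\<^sub>R ((dd (dd u x) v x + dd u (dd (\<lambda>y. y) v x) x) - dd u v x))"
      using has_derivative_unique by simp
    from fun_cong[OF this, of v]
    have 1: "(\<Sum>i\<in>UNIV. dd (dd (dd u v) (e i x)) (e i x) x) +
        2 *\<^sub>R (\<Sum>i\<in>UNIV. dd (dd u (e i x)) (dd (e i) v x) x) = (1/2) *\<^sub>R dd (dd u x) v x"
      by (simp add: sum.distrib scaleR_sum_right dd_def[of "\<lambda>y. y"])
    \<comment> \<open>The frame stays orthonormal, so the derivative of
      \<open>g y (e i y) (e j y)\<close> is 0. This fixes the symmetric part of \<open>M\<close>;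
      \<open>T\<close> comes from differentiating the metric.\<close>
    have MT: "M i j + M j i = T i j + T j i" for i j
    proof -
      have "((\<lambda>y. e i y \<bullet> e j y - dd u (e i y) y \<bullet> dd u (e j y) y) has_derivative
        (\<lambda>v. (e i x \<bullet> dd (e j) v x + dd (e i) v x \<bullet> e j x) -
          (dd u (e i x) x \<bullet> (dd (dd u (e j x)) v x + dd u (dd (e j) v x) x)
           + (dd (dd u (e i x)) v x + dd u (dd (e i) v x) x) \<bullet> dd u (e j x) x))) (at x)"
        by (intro has_derivative_diff has_derivative_inner has_derivative_dd_along smooth_u
            smooth_has_derivative smooth_differentiable e)
      moreover have "e i y \<bullet> e j y - dd u (e i y) y \<bullet> dd u (e j y) y = (if i = j then 1 else 0)" for y
        using e(2)[of y] by (simp add: orthonormal_def g_def)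
      ultimately have "(\<lambda>v. (e i x \<bullet> dd (e j) v x + dd (e i) v x \<bullet> e j x) -
          (dd u (e i x) x \<bullet> (dd (dd u (e j x)) v x + dd u (dd (e j) v x) x)
           + (dd (dd u (e i x)) v x + dd u (dd (e i) v x) x) \<bullet> dd u (e j x) x)) = (\<lambda>v. 0)"
        using has_derivative_unique[OF _ has_derivative_const] by simp
      from fun_cong[OF this, of v] show ?thesis
        using dd_commute[OF smooth_u, of "e i x" v] dd_commute[OF smooth_u, of "e j x" v]
        by (simp add: M_def T_def g_def inner_add inner_commute)
    qed
    have "dd (dd u (e i x)) (dd (e i) v x) x = (\<Sum>j\<in>UNIV. M i j *\<^sub>R U i j)" for i
    proof -
      have "dd (dd u (e i x)) (dd (e i) v x) x = dd (dd u (e i x)) (\<Sum>j\<in>UNIV. M i j *\<^sub>R e j x) x"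
        unfolding M_def by (simp add: orthonormal_expansion[OF e(2)])
      then show ?thesis by (simp add: dd_sum dd_scaleR s U_def)
    qed
    \<comment> \<open>Paired with the symmetric \<open>U\<close>, only the symmetric part of
      \<open>M\<close> survives.\<close>
    then have "2 *\<^sub>R (\<Sum>i\<in>UNIV. dd (dd u (e i x)) (dd (e i) v x) x)
       = (\<Sum>i\<in>UNIV. \<Sum>j\<in>UNIV. M i j *\<^sub>R U i j) + (\<Sum>i\<in>UNIV. \<Sum>j\<in>UNIV. M j i *\<^sub>R U i j)"
      using sum.swap[of "\<lambda>i j. M j i *\<^sub>R U i j" UNIV UNIV] U_sym by (simp add: scaleR_2)
    also have "\<dots> = (\<Sum>i\<in>UNIV. \<Sum>j\<in>UNIV. (M i j + M j i) *\<^sub>R U i j)"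
      by (simp add: scaleR_add_left sum.distrib)
    also have "\<dots> = (\<Sum>i\<in>UNIV. \<Sum>j\<in>UNIV. T i j *\<^sub>R U i j) + (\<Sum>i\<in>UNIV. \<Sum>j\<in>UNIV. T j i *\<^sub>R U i j)"
      by (simp add: MT scaleR_add_left sum.distrib)
    also have "\<dots> = 2 *\<^sub>R (\<Sum>i\<in>UNIV. \<Sum>j\<in>UNIV. T i j *\<^sub>R U i j)"
      using sum.swap[of "\<lambda>i j. T j i *\<^sub>R U i j" UNIV UNIV] U_sym by (simp add: scaleR_2)
    finally show ?thesis using 1 unfolding T_def U_def by (simp add: algebra_simps)
  qed
  then show ?thesis using e(2) by blast
qed

text \<open>The barrier is tested along \<open>x + t v\<close> with the coefficient \<open>a0 + t (v - q)\<close> of the tangent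
  vector; \<open>q\<close> is a free parameter, chosen later to make the second order inequality strongest.\<close>

lemma test_function_derivatives:
  fixes Q :: "real \<Rightarrow> real"
  assumes Q: "\<And>y. y \<ge> 0 \<Longrightarrow> (Q has_real_derivative Q' y) (at y)"
    and Q': "(Q' has_real_derivative Q'') (at (zz x))"
    and zz: "\<And>x. zz x \<ge> 0"
    and max: "\<And>y a. (u y - dd u a y) \<bullet> (u y - dd u a y) - (y - a) \<bullet> (y - a) - Q (zz y) \<le>
      (u x - dd u a0 x) \<bullet> (u x - dd u a0 x) - (x - a0) \<bullet> (x - a0) - Q (zz x)"
  defines "\<eta> \<equiv> u x - dd u a0 x" and "z1 v \<equiv> 2 * (x \<bullet> v - u x \<bullet> dd u v x)"
  shows "2 * (\<eta> \<bullet> (dd u q x - dd (dd u a0) v x)) - 2 * ((x - a0) \<bullet> q) = Q' (zz x) * z1 v"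
    and "2 * ((dd u q x - dd (dd u a0) v x) \<bullet> (dd u q x - dd (dd u a0) v x)) - 2 * (q \<bullet> q)
      + 2 * (\<eta> \<bullet> (2 *\<^sub>R dd (dd u q) v x - dd (dd u v) v x - dd (dd (dd u a0) v) v x))
      \<le> Q'' * (z1 v)\<^sup>2 + Q' (zz x) * (2 * (v \<bullet> v - dd u v x \<bullet> dd u v x - u x \<bullet> dd (dd u v) v x))"
proof -
  define p where "p = v - q"
  have dp: "dd u p y = dd u v y - dd u q y" for y by (simp add: p_def dd_diff smooth_u)
  have ddp: "dd (dd u p) v x = dd (dd u v) v x - dd (dd u q) v x"
    unfolding p_def using linear_diff[OF linear_dd_dd[OF smooth_u]] .
  define c where "c t = x + t *\<^sub>R v" for t :: real
  define E where "E t = u (c t) - dd u a0 (c t) - t *\<^sub>R dd u p (c t)" for t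
  define E1 where "E1 t = dd u v (c t) - dd (dd u a0) v (c t) - dd u p (c t) - t *\<^sub>R dd (dd u p) v (c t)" for t
  define E2 where "E2 = dd (dd u v) v x - dd (dd (dd u a0) v) v x - 2 *\<^sub>R dd (dd u p) v x"
  define b where "b t = c t - a0 - t *\<^sub>R p" for t
  define \<zeta> where "\<zeta> t = 2 * (c t \<bullet> v - u (c t) \<bullet> dd u v (c t))" for t
  define \<zeta>' where "\<zeta>' = 2 * (v \<bullet> v - dd u v x \<bullet> dd u v x - u x \<bullet> dd (dd u v) v x)"
  have L: "((\<lambda>t. f (c t)) has_vector_derivative dd f v (c t)) (at t)"
    if "smooth f" for f :: "real^'m \<Rightarrow> 'c::euclidean_space" and t
    unfolding c_def by (rule has_vector_derivative_along_line[OF that])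
  have inner: "((\<lambda>t. f t \<bullet> h t) has_real_derivative (f t \<bullet> h' + f' \<bullet> h t)) (at t)"
    if "(f has_vector_derivative f') (at t)" "(h has_vector_derivative h') (at t)"
    for f h :: "real \<Rightarrow> 'c::real_inner" and f' h' t
    unfolding has_real_derivative_iff_has_vector_derivative
    by (rule bounded_bilinear.has_vector_derivative[OF bounded_bilinear_inner that])
  have sc: "((\<lambda>t. t *\<^sub>R f t) has_vector_derivative (f t + t *\<^sub>R f')) (at t)"
    if "(f has_vector_derivative f') (at t)" for f :: "real \<Rightarrow> 'c::euclidean_space" and f' t
    using has_vector_derivative_scaleR[OF DERIV_ident that] by (simp add: add.commute)
  have dc: "(c has_vector_derivative v) (at t)" for t
    unfolding c_def by (auto intro!: derivative_eq_intros)
  have dE: "(E has_vector_derivative E1 t) (at t)" for t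
  proof -
    have "(E has_vector_derivative dd u v (c t) - dd (dd u a0) v (c t)
      - (dd u p (c t) + t *\<^sub>R dd (dd u p) v (c t))) (at t)"
      unfolding E_def[abs_def] by (intro has_vector_derivative_diff sc L smooth_u smooth_dd)
    then show ?thesis by (simp add: E1_def algebra_simps)
  qed
  have dE1: "(E1 has_vector_derivative E2) (at 0)"
  proof -
    have "(E1 has_vector_derivative dd (dd u v) v (c 0) - dd (dd (dd u a0) v) v (c 0) - dd (dd u p) v (c 0)
      - (dd (dd u p) v (c 0) + 0 *\<^sub>R dd (dd (dd u p) v) v (c 0))) (at 0)"
      unfolding E1_def[abs_def]
      by (intro has_vector_derivative_diff sc L smooth_u smooth_dd)
    then show ?thesis by (simp add: E2_def c_def scaleR_2 algebra_simps)
  qed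
  have db: "(b has_vector_derivative q) (at t)" for t
  proof -
    have "(b has_vector_derivative v - 0 - (p + t *\<^sub>R 0)) (at t)"
      unfolding b_def[abs_def] by (intro has_vector_derivative_diff sc dc has_vector_derivative_const)
    then show ?thesis by (simp add: p_def)
  qed
  have dz: "((\<lambda>t. zz (c t)) has_real_derivative \<zeta> t) (at t)" for t
    using DERIV_diff[OF inner[OF dc dc] inner[OF L[OF smooth_u] L[OF smooth_u]], of t]
    by (simp add: \<zeta>_def inner_commute)
  have dz2: "(\<zeta> has_real_derivative \<zeta>') (at 0)"
  proof -
    have "((\<lambda>t. 2 * (c t \<bullet> v - u (c t) \<bullet> dd u v (c t))) has_real_derivative
      2 * ((c 0 \<bullet> 0 + v \<bullet> v) - (u (c 0) \<bullet> dd (dd u v) v (c 0) + dd u v (c 0) \<bullet> dd u v (c 0)))) (at 0)"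
      by (intro DERIV_cmult DERIV_diff inner dc L has_vector_derivative_const smooth_u smooth_dd)
    then show ?thesis unfolding \<zeta>_def[abs_def] \<zeta>'_def by (simp add: c_def algebra_simps)
  qed
  define \<phi> where "\<phi> t = E t \<bullet> E t - b t \<bullet> b t - Q (zz (c t))" for t
  define \<phi>1 where "\<phi>1 t = 2 * (E t \<bullet> E1 t) - 2 * (b t \<bullet> q) - Q' (zz (c t)) * \<zeta> t" for t
  have 1: "(\<phi> has_real_derivative \<phi>1 t) (at t)" for t
  proof -
    have "(\<phi> has_real_derivative (E t \<bullet> E1 t + E1 t \<bullet> E t) - (b t \<bullet> q + q \<bullet> b t) - Q' (zz (c t)) * \<zeta> t) (at t)"
      unfolding \<phi>_def[abs_def] by (intro DERIV_diff inner dE db DERIV_chain2[OF Q[OF zz] dz])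
    then show ?thesis by (simp add: \<phi>1_def inner_commute)
  qed
  have c0: "c 0 = x" by (simp add: c_def)
  have 2: "(\<phi>1 has_real_derivative 2 * (E 0 \<bullet> E2 + E1 0 \<bullet> E1 0) - 2 * (b 0 \<bullet> 0 + q \<bullet> q)
      - (Q'' * \<zeta> 0 * \<zeta> 0 + \<zeta>' * Q' (zz (c 0)))) (at 0)"
    unfolding \<phi>1_def[abs_def]
    by (intro DERIV_diff DERIV_cmult inner dE dE1 db has_vector_derivative_const
       DERIV_mult dz2 DERIV_chain2[OF Q'[folded c0] dz])
  \<comment> \<open>Linearity of \<open>dd u\<close> in the direction makes \<open>E t\<close> and
    \<open>b t\<close> the residuals belonging to the coefficient \<open>a0 + t *\<^sub>R p\<close>,
    so \<open>max\<close> applies at every \<open>t\<close>.\<close>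
  have 3: "\<phi> t \<le> \<phi> 0" for t
  proof -
    have Et: "E t = u (c t) - dd u (a0 + t *\<^sub>R p) (c t)"
      by (simp add: E_def dd_add dd_scaleR smooth_u)
    have bt: "b t = c t - (a0 + t *\<^sub>R p)" by (simp add: b_def)
    have "\<phi> 0 = (u x - dd u a0 x) \<bullet> (u x - dd u a0 x) - (x - a0) \<bullet> (x - a0) - Q (zz x)"
      by (simp add: \<phi>_def c0 E_def b_def)
    then show ?thesis using max[of "c t" "a0 + t *\<^sub>R p"] unfolding \<phi>_def Et bt by simp
  qed
  have vals: "E 0 = \<eta>" "b 0 = x - a0" "\<zeta> 0 = z1 v" "E1 0 = dd u q x - dd (dd u a0) v x"
     "E2 = 2 *\<^sub>R dd (dd u q) v x - dd (dd u v) v x - dd (dd (dd u a0) v) v x"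
    by (simp_all add: E_def b_def \<zeta>_def E1_def c0 \<eta>_def z1_def dp E2_def ddp scaleR_2 algebra_simps)
  have "\<phi>1 0 = 0" using second_derivative_at_max(1)[OF 1 2 3] .
  then show "2 * (\<eta> \<bullet> (dd u q x - dd (dd u a0) v x)) - 2 * ((x - a0) \<bullet> q) = Q' (zz x) * z1 v"
    by (simp add: \<phi>1_def c0 vals)
  have "2 * (E 0 \<bullet> E2 + E1 0 \<bullet> E1 0) - 2 * (b 0 \<bullet> 0 + q \<bullet> q)
      - (Q'' * \<zeta> 0 * \<zeta> 0 + \<zeta>' * Q' (zz (c 0))) \<le> 0"
    using second_derivative_at_max(2)[OF 1 2 3] .
  then show "2 * ((dd u q x - dd (dd u a0) v x) \<bullet> (dd u q x - dd (dd u a0) v x)) - 2 * (q \<bullet> q)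
      + 2 * (\<eta> \<bullet> (2 *\<^sub>R dd (dd u q) v x - dd (dd u v) v x - dd (dd (dd u a0) v) v x))
      \<le> Q'' * (z1 v)\<^sup>2 + Q' (zz x) * (2 * (v \<bullet> v - dd u v x \<bullet> dd u v x - u x \<bullet> dd (dd u v) v x))"
    unfolding c0 vals(1,3,4) unfolding vals(5) \<zeta>'_def by (simp add: power2_eq_square algebra_simps)
qed

end

section \<open>The inequality at a maximum point\<close>

context spacelike_graph
begin

text \<open>The hypothesis says that (b, \<eta>) is normal. With \<open>v = b\<close> it gives |b|^2
  <= |\<eta>| |Du b|, and Du does not lengthen vectors.\<close>

lemma normal_timelike:
  assumes "\<And>v. b \<bullet> v = \<eta> \<bullet> dd u v x"
  shows "b \<bullet> b \<le> \<eta> \<bullet> \<eta>"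
proof -
  have "norm (dd u b x) \<le> norm b"
    using g_nonneg[of x b] by (simp add: g_def norm_le)
  have "norm b * norm b = \<eta> \<bullet> dd u b x"
    using assms[of b] by (simp add: power2_norm_eq_inner flip: power2_eq_square)
  also have "\<dots> \<le> norm \<eta> * norm (dd u b x)" by (rule norm_cauchy_schwarz)
  also have "\<dots> \<le> norm \<eta> * norm b" using \<open>norm (dd u b x) \<le> norm b\<close> by (rule mult_left_mono) simp
  finally have "norm b \<le> norm \<eta>" by (cases "b = 0") auto
  then show ?thesis by (simp add: norm_le)
qed

text \<open>The second factor on the right is -<n, n> for the normal part n of (0, y). Minus the
  pseudo inner product is nonnegative on normal vectors by \<open>normal_timelike\<close>, so this
  is Cauchy-Schwarz for n and (b, \<eta>).\<close>

lemma normal_Cauchy_Schwarz: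
  assumes b: "\<And>v. b \<bullet> v = \<eta> \<bullet> dd u v x" and F: "F = \<eta> \<bullet> \<eta> - b \<bullet> b" "F > 0"
    and c: "orthonormal x c"
  shows "(\<eta> \<bullet> y)\<^sup>2 \<le> F * (y \<bullet> y + (\<Sum>j\<in>UNIV. (y \<bullet> dd u (c j) x)\<^sup>2))"
proof -
  define p where "p = (\<Sum>j\<in>UNIV. (y \<bullet> dd u (c j) x) *\<^sub>R c j)"
  have gp: "g x p v = y \<bullet> dd u v x" for v
  proof -
    have "y \<bullet> dd u v x = y \<bullet> dd u (\<Sum>j\<in>UNIV. g x v (c j) *\<^sub>R c j) x"
      by (simp add: orthonormal_expansion[OF c])
    then show ?thesis
      by (simp add: p_def g_sum_left g_scaleR_left dd_sum dd_scaleR smooth_u inner_sum_right mult.commute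
          g_sym[of x v])
  qed
  define \<zeta> where "\<zeta> = y + dd u p x"
  have p: "p \<bullet> v = \<zeta> \<bullet> dd u v x" for v
    using gp[of v] by (simp add: g_def \<zeta>_def inner_add)
  have gpp: "g x p p = (\<Sum>j\<in>UNIV. (y \<bullet> dd u (c j) x)\<^sup>2)"
    using orthonormal_Parseval[OF c, of p p] by (simp add: gp power2_eq_square)
  define N where "N = \<zeta> \<bullet> \<zeta> - p \<bullet> p"
  have N: "N = y \<bullet> y + g x p p"
    using gp[of p] by (simp add: N_def \<zeta>_def g_def inner_add inner_commute)
  define k where "k = \<eta> \<bullet> y"
  have k: "\<eta> \<bullet> \<zeta> - b \<bullet> p = k"
    using b[of p] by (simp add: k_def \<zeta>_def inner_add)
  \<comment> \<open>The usual discriminant argument: the combination F n - k (b, \<eta>) is normal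
    again.\<close>
  have "(F *\<^sub>R p - k *\<^sub>R b) \<bullet> (F *\<^sub>R p - k *\<^sub>R b) \<le> (F *\<^sub>R \<zeta> - k *\<^sub>R \<eta>) \<bullet> (F *\<^sub>R \<zeta> - k *\<^sub>R \<eta>)"
    by (rule normal_timelike) (simp add: inner_diff_left p b)
  then have "0 \<le> F * F * (\<zeta> \<bullet> \<zeta> - p \<bullet> p) - 2 * F * k * (\<eta> \<bullet> \<zeta> - b \<bullet> p) + k * k * (\<eta> \<bullet> \<eta> - b \<bullet> b)"
    by (simp add: inner_diff_left inner_diff_right inner_commute algebra_simps)
  also have "\<dots> = F * (F * N - k\<^sup>2)"
    unfolding k N_def[symmetric] F(1)[symmetric] by (simp add: power2_eq_square algebra_simps)
  finally have "k\<^sup>2 \<le> F * N" using F(2) by (simp add: zero_le_mult_iff)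
  then show ?thesis by (simp add: k_def N gpp)
qed

end

context graph_shrinker
begin

text \<open>\<open>Q\<close> is meant to be a multiple of exp h with value \<open>F\<close> at the
  maximum; then Q' = F h' and Q'' = F (h'' + h'^2), with \<open>h1\<close>, \<open>h2\<close> for
  h', h''. The common factor \<open>F\<close> is divided out at the end, so the leading 1 is the
  term F of the Simons inequality.\<close>

lemma maximum_point_inequality:
  fixes Q :: "real \<Rightarrow> real"
  assumes Q: "\<And>y. y \<ge> 0 \<Longrightarrow> (Q has_real_derivative Q' y) (at y)"
    and Q': "(Q' has_real_derivative F * (h2 + h1\<^sup>2)) (at (zz x))" and h1: "Q' (zz x) = F * h1"
    and zz: "\<And>x. zz x \<ge> 0"
    and max: "\<And>y a. (u y - dd u a y) \<bullet> (u y - dd u a y) - (y - a) \<bullet> (y - a) - Q (zz y) \<le>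
      (u x - dd u a0 x) \<bullet> (u x - dd u a0 x) - (x - a0) \<bullet> (x - a0) - Q (zz x)"
    and normal: "\<And>v. (x - a0) \<bullet> v = (u x - dd u a0 x) \<bullet> dd u v x"
    and F: "F = (u x - dd u a0 x) \<bullet> (u x - dd u a0 x) - (x - a0) \<bullet> (x - a0)" "F > 0"
  shows "1 + 2 * (1/2 - h1)\<^sup>2 * F / real CARD('m)
    \<le> 2 * h1\<^sup>2 * zz x + 4 * h2 * (zz x + F) + h1 * (2 * real CARD('m) - zz x)"
proof -
  define m where "m = real CARD('m)"
  define \<eta> where "\<eta> = u x - dd u a0 x"
  define b where "b = x - a0"
  define w where "w = dd u x x - u x"
  have u_eq: "u x = \<eta> + dd u a0 x" and x_eq: "x = b + a0" by (simp_all add: \<eta>_def b_def)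
  note normal = normal[folded \<eta>_def b_def]
  note F' = F(1)[folded \<eta>_def b_def]
  note test = test_function_derivatives[OF Q Q' zz max, folded \<eta>_def b_def, unfolded h1]
  obtain c where c: "orthonormal x c" and lin: "\<And>v.
     (\<Sum>i\<in>UNIV. dd (dd (dd u v) (c i)) (c i) x) = (1/2) *\<^sub>R dd (dd u x) v x
       - 2 *\<^sub>R (\<Sum>i\<in>UNIV. \<Sum>j\<in>UNIV. (dd (dd u v) (c i) x \<bullet> dd u (c j) x) *\<^sub>R dd (dd u (c i)) (c j) x)"
    using orthonormal_linearized_equation[of x] by blast
  have cc: "g x (c i) (c j) = (if i = j then 1 else 0)" for i j
    using c by (simp add: orthonormal_def)
  define H where "H i j = dd (dd u (c i)) (c j) x" for i j
  define D3 where "D3 i = dd (dd (dd u a0) (c i)) (c i) x" for i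
  define y where "y i = dd (dd u a0) (c i) x" for i
  \<comment> \<open>For normal n = (b, \<eta>), <(0, y), n> = - \<eta> . y, so \<open>al\<close> is
    minus the matrix of A; this explains the signs of its trace and eigenvalue. The vectors
    \<open>y i\<close> are D^2 u (a0, c_i), whose normal parts are the B(e_i, X^T).\<close>
  define al where "al i j = \<eta> \<bullet> H i j" for i j
  define t where "t i j = y i \<bullet> dd u (c j) x" for i j
  define a where "a i = g x a0 (c i)" for i
  define \<tau> where "\<tau> = zz x + F"
  have al_sym: "al i j = al j i" for i j
    using dd_commute[OF smooth_u, of "c i" "c j"] by (simp add: al_def H_def)
  have ba0: "b \<bullet> a0 = \<eta> \<bullet> dd u a0 x" by (rule normal)
  \<comment> \<open>Half the differential of \<open>zz\<close> is the pairing with X^T, whose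
    coefficient is \<open>a0\<close>. Hence \<tau>, the square length of X^T, is a quarter of |grad
    z|^2.\<close>
  have z1: "x \<bullet> v - u x \<bullet> dd u v x = g x a0 v" for v
    using normal[of v] by (subst x_eq, subst u_eq) (simp add: g_def inner_add)
  \<comment> \<open>The first order test holds for every \<open>q\<close>; with \<open>q = 0\<close>
    it is the gradient condition.\<close>
  have first: "\<eta> \<bullet> dd (dd u a0) v x = - F * h1 * g x a0 v" for v
  proof -
    have "2 * (\<eta> \<bullet> (dd u 0 x - dd (dd u a0) v x)) - 2 * (b \<bullet> 0) = F * h1 * (2 * g x a0 v)"
      using test(1)[of 0 v] unfolding z1 .
    then show ?thesis unfolding dd_zero[OF smooth_u] by (simp only: inner_diff_right inner_zero_right) algebra
  qed
  have \<eta>y: "\<eta> \<bullet> y i = - F * h1 * a i" for i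
    by (simp add: y_def first a_def)
  have \<tau>: "g x a0 a0 = \<tau>"
  proof -
    have "x \<bullet> x = b \<bullet> b + 2 * (b \<bullet> a0) + a0 \<bullet> a0"
      by (subst (1 2) x_eq) (simp add: inner_add inner_commute)
    moreover have "u x \<bullet> u x = \<eta> \<bullet> \<eta> + 2 * (\<eta> \<bullet> dd u a0 x) + dd u a0 x \<bullet> dd u a0 x"
      by (subst (1 2) u_eq) (simp add: inner_add inner_commute)
    ultimately show ?thesis using ba0 F' by (simp add: \<tau>_def g_def)
  qed
  have sum_a: "(\<Sum>i\<in>UNIV. (a i)\<^sup>2) = \<tau>"
    using orthonormal_Parseval[OF c, of a0 a0] by (simp add: a_def \<tau> power2_eq_square)
  have \<tau>_pos: "\<tau> > 0" using F(2) zz[of x] by (simp add: \<tau>_def)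
  have \<eta>w: "\<eta> \<bullet> w = - F"
  proof -
    have "\<eta> \<bullet> dd u x x = b \<bullet> b + b \<bullet> a0"
      unfolding normal[of x, symmetric] by (subst x_eq) (simp add: inner_add)
    moreover have "\<eta> \<bullet> u x = \<eta> \<bullet> \<eta> + \<eta> \<bullet> dd u a0 x" by (subst u_eq) (simp add: inner_add)
    ultimately show ?thesis using ba0 F' by (simp add: w_def inner_diff_right)
  qed
  have H_tr: "(\<Sum>i\<in>UNIV. H i i) = (1/2) *\<^sub>R w"
    unfolding H_def w_def using hess_trace_eq[OF c] shrinker by metis
  have al_tr: "(\<Sum>i\<in>UNIV. al i i) = - F / 2"
    using \<eta>w H_tr by (simp add: al_def flip: inner_sum_right)
  \<comment> \<open>The linearized equation in the direction \<open>a0\<close> replaces the third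
    derivatives; the gradient condition evaluates its term D^2 u (x, a0).\<close>
  have D3_tr: "2 * (\<eta> \<bullet> (\<Sum>i\<in>UNIV. D3 i)) =
      - (F * h1 * (zz x - u x \<bullet> w)) - 4 * (\<Sum>i\<in>UNIV. \<Sum>j\<in>UNIV. t i j * al i j)"
  proof -
    have "g x a0 x = zz x - u x \<bullet> w"
      using z1[of x] by (simp add: w_def inner_diff_right)
    moreover have "dd (dd u x) a0 = dd (dd u a0) x" by (rule dd_commute[OF smooth_u])
    ultimately have "\<eta> \<bullet> dd (dd u x) a0 x = - F * h1 * (zz x - u x \<bullet> w)" by (simp add: first)
    then show ?thesis unfolding D3_def lin
      by (simp add: t_def al_def H_def y_def inner_diff_right inner_sum_right)
  qed
  have each: "2 * (\<Sum>j\<in>UNIV. (al i j - t i j)\<^sup>2) + 2 * (y i \<bullet> y i) - 2 * al i i - 2 * (\<eta> \<bullet> D3 i)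
      \<le> 4 * F * (h2 + h1\<^sup>2) * (a i)\<^sup>2 + F * h1 * (2 - 2 * (u x \<bullet> H i i))" for i
  proof -
    (* maximizes the quadratic polynomial in q on the left-hand side of the second order test *)
    define q where "q = (\<Sum>j\<in>UNIV. (al i j - t i j) *\<^sub>R c j)"
    have gq: "g x q (c j) = al i j - t i j" for j
    proof -
      have "g x q (c j) = (\<Sum>k\<in>UNIV. if k = j then al i k - t i k else 0)"
        unfolding q_def g_sum_left g_scaleR_left cc by (intro sum.cong) auto
      then show ?thesis by simp
    qed
    have qq: "dd u q x \<bullet> dd u q x - q \<bullet> q = - (\<Sum>j\<in>UNIV. (al i j - t i j)\<^sup>2)"
      using orthonormal_Parseval[OF c, of q q] by (simp add: gq power2_eq_square) (simp add: g_def)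
    have qy: "dd u q x \<bullet> y i = (\<Sum>j\<in>UNIV. (al i j - t i j) * t i j)"
      by (simp add: q_def dd_sum dd_scaleR smooth_u inner_sum_left t_def inner_commute[of _ "y i"] inner_sum_right)
    have q\<eta>: "\<eta> \<bullet> dd (dd u q) (c i) x = (\<Sum>j\<in>UNIV. (al i j - t i j) * al i j)"
    proof -
      have "dd (dd u q) (c i) x = (\<Sum>j\<in>UNIV. (al i j - t i j) *\<^sub>R H j i)"
        unfolding q_def by (simp add: linear_sum[OF linear_dd_dd[OF smooth_u]]
            linear_scale[OF linear_dd_dd[OF smooth_u]] H_def)
      then have "\<eta> \<bullet> dd (dd u q) (c i) x = (\<Sum>j\<in>UNIV. (al i j - t i j) * al j i)"
        by (simp add: inner_sum_right al_def)
      then show ?thesis by (simp add: al_sym[of _ i])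
    qed
    have S: "(\<Sum>j\<in>UNIV. (al i j - t i j) * al i j) - (\<Sum>j\<in>UNIV. (al i j - t i j) * t i j)
       = (\<Sum>j\<in>UNIV. (al i j - t i j)\<^sup>2)"
      by (simp add: power2_eq_square algebra_simps flip: sum_subtractf)
    have ccii: "c i \<bullet> c i - dd u (c i) x \<bullet> dd u (c i) x = 1"
      using cc[of i i] by (simp add: g_def)
    have R: "F * (h2 + h1\<^sup>2) * (2 * a i)\<^sup>2 + F * h1 * (2 * (1 - u x \<bullet> H i i))
        = 4 * F * (h2 + h1\<^sup>2) * (a i)\<^sup>2 + F * h1 * (2 - 2 * (u x \<bullet> H i i))"
      by algebra
    have le: "2 * ((dd u q x - y i) \<bullet> (dd u q x - y i)) - 2 * (q \<bullet> q)
      + 2 * (\<eta> \<bullet> (2 *\<^sub>R dd (dd u q) (c i) x - H i i - D3 i))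
      \<le> F * (h2 + h1\<^sup>2) * (2 * a i)\<^sup>2 + F * h1 * (2 * (1 - u x \<bullet> H i i))"
      using test(2)[of q "c i"] unfolding z1 ccii by (simp only: y_def H_def D3_def a_def)
    have l1: "2 * ((dd u q x - y i) \<bullet> (dd u q x - y i)) - 2 * (q \<bullet> q)
        = 2 * (dd u q x \<bullet> dd u q x - q \<bullet> q) - 4 * (dd u q x \<bullet> y i) + 2 * (y i \<bullet> y i)"
      by (simp add: inner_diff_left inner_diff_right inner_commute)
    have l2: "2 * (\<eta> \<bullet> (2 *\<^sub>R dd (dd u q) (c i) x - H i i - D3 i)) =
        4 * (\<eta> \<bullet> dd (dd u q) (c i) x) - 2 * al i i - 2 * (\<eta> \<bullet> D3 i)"
      by (simp add: inner_diff_right al_def)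
    \<comment> \<open>The bookkeeping is done over fresh real variables, so that the sums and inner
      products stay atoms.\<close>
    have "2 * S2 + 2 * C - 2 * E - 2 * G \<le> R"
      if "L1 + L2 \<le> R" "L1 = 2 * A - 4 * B + 2 * C" "L2 = 4 * D - 2 * E - 2 * G"
        "A = - S2" "B = Qt" "D = Qa" "Qa - Qt = S2" for L1 L2 R A B C D E G S2 Qt Qa :: real
      using that by linarith
    from this[OF le[unfolded R] l1 l2 qq qy q\<eta> S] show ?thesis .
  qed
  have s1: "(\<Sum>i\<in>UNIV. 2 * (\<Sum>j\<in>UNIV. (al i j - t i j)\<^sup>2) + 2 * (y i \<bullet> y i) - 2 * al i i - 2 * (\<eta> \<bullet> D3 i))
      \<le> (\<Sum>i\<in>UNIV. 4 * F * (h2 + h1\<^sup>2) * (a i)\<^sup>2 + F * h1 * (2 - 2 * (u x \<bullet> H i i)))"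
    by (rule sum_mono) (rule each)
  have s2: "(\<Sum>i\<in>UNIV. 4 * F * (h2 + h1\<^sup>2) * (a i)\<^sup>2 + F * h1 * (2 - 2 * (u x \<bullet> H i i)))
      = 4 * F * (h2 + h1\<^sup>2) * \<tau> + F * h1 * (2 * m - u x \<bullet> w)"
  proof -
    have "(\<Sum>i\<in>UNIV. F * h1 * (2 - 2 * (u x \<bullet> H i i))) = F * h1 * (2 * m - 2 * (u x \<bullet> (\<Sum>i\<in>UNIV. H i i)))"
      by (simp add: inner_sum_right sum_subtractf m_def mult.commute flip: sum_distrib_left)
    then show ?thesis using sum_a by (simp add: sum.distrib H_tr flip: sum_distrib_left)
  qed
  have s3: "(\<Sum>i\<in>UNIV. 2 * (\<Sum>j\<in>UNIV. (al i j - t i j)\<^sup>2) + 2 * (y i \<bullet> y i) - 2 * al i i - 2 * (\<eta> \<bullet> D3 i))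
     = 2 * (\<Sum>i\<in>UNIV. \<Sum>j\<in>UNIV. (al i j - t i j)\<^sup>2) + 2 * (\<Sum>i\<in>UNIV. y i \<bullet> y i) + F
       - 2 * (\<eta> \<bullet> (\<Sum>i\<in>UNIV. D3 i))"
    using al_tr by (simp add: sum.distrib sum_subtractf inner_sum_right flip: sum_distrib_left)
  have s4: "(\<Sum>i\<in>UNIV. \<Sum>j\<in>UNIV. (al i j - t i j)\<^sup>2) = (\<Sum>i\<in>UNIV. \<Sum>j\<in>UNIV. (al i j)\<^sup>2)
      + (\<Sum>i\<in>UNIV. \<Sum>j\<in>UNIV. (t i j)\<^sup>2) - 2 * (\<Sum>i\<in>UNIV. \<Sum>j\<in>UNIV. t i j * al i j)"
    by (simp add: power2_diff sum.distrib sum_subtractf sum_distrib_left mult.commute mult.left_commute)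
  have "F' + 2 * A + 2 * (Y + T) + q \<le> R" if "L \<le> R0" "R0 = R"
    "L = 2 * P + 2 * Y + F' - e" "P = A + T - 2 * TA" "e = - q - 4 * TA"
    for F' A Y T q R L R0 P e TA :: real
    using that by simp
  \<comment> \<open>The mixed sums of \<open>t i j * al i j\<close> cancel: the expanded square
    contributes -4 times the sum, the linearized equation +4 times.\<close>
  from this[OF s1 s2 s3 s4 D3_tr] have main: "F + 2 * (\<Sum>i\<in>UNIV. \<Sum>j\<in>UNIV. (al i j)\<^sup>2)
      + 2 * ((\<Sum>i\<in>UNIV. y i \<bullet> y i) + (\<Sum>i\<in>UNIV. \<Sum>j\<in>UNIV. (t i j)\<^sup>2)) + F * h1 * (zz x - u x \<bullet> w)
      \<le> 4 * F * (h2 + h1\<^sup>2) * \<tau> + F * h1 * (2 * m - u x \<bullet> w)"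
    .
  have al_a: "(\<Sum>j\<in>UNIV. al i j * a j) = (- F * h1) * a i" for i
  proof -
    have "y i = dd (dd u (\<Sum>j\<in>UNIV. a j *\<^sub>R c j)) (c i) x"
      unfolding a_def y_def orthonormal_expansion[OF c] ..
    also have "\<dots> = (\<Sum>j\<in>UNIV. a j *\<^sub>R H j i)"
      by (simp add: linear_sum[OF linear_dd_dd[OF smooth_u]] linear_scale[OF linear_dd_dd[OF smooth_u]] H_def)
    finally have "\<eta> \<bullet> y i = (\<Sum>j\<in>UNIV. a j * al j i)" by (simp add: inner_sum_right al_def)
    then show ?thesis using \<eta>y[of i] by (simp add: al_sym[of _ i] mult.commute)
  qed
  have "(- F * h1)\<^sup>2 + ((\<Sum>i\<in>UNIV. al i i) - (- F * h1))\<^sup>2 / m \<le> (\<Sum>i\<in>UNIV. \<Sum>j\<in>UNIV. (al i j)\<^sup>2)"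
    unfolding m_def by (rule sum_squares_ge_eigenvalue_trace[where a=a, OF al_a sum_a \<tau>_pos])
  moreover have "(- F / 2 - (- F * h1))\<^sup>2 = F * (F * (1/2 - h1)\<^sup>2)"
    by (simp add: power2_eq_square algebra_simps)
  ultimately have A: "F * (F * h1\<^sup>2 + F * (1/2 - h1)\<^sup>2 / m) \<le> (\<Sum>i\<in>UNIV. \<Sum>j\<in>UNIV. (al i j)\<^sup>2)"
    unfolding al_tr by (simp add: power2_eq_square algebra_simps)
  \<comment> \<open>This is |B(e_i, X^T)|^2 bounded below by its component along X^N, which the
    gradient condition gives.\<close>
  have "F * h1\<^sup>2 * (a i)\<^sup>2 \<le> y i \<bullet> y i + (\<Sum>j\<in>UNIV. (t i j)\<^sup>2)" for i
  proof -
    have "(\<eta> \<bullet> y i)\<^sup>2 \<le> F * (y i \<bullet> y i + (\<Sum>j\<in>UNIV. (t i j)\<^sup>2))"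
      unfolding t_def by (rule normal_Cauchy_Schwarz[OF normal F' F(2) c])
    then have "F * (F * h1\<^sup>2 * (a i)\<^sup>2) \<le> F * (y i \<bullet> y i + (\<Sum>j\<in>UNIV. (t i j)\<^sup>2))"
      unfolding \<eta>y by (simp add: power2_eq_square algebra_simps)
    then show ?thesis using F(2) by simp
  qed
  then have "(\<Sum>i\<in>UNIV. F * h1\<^sup>2 * (a i)\<^sup>2) \<le> (\<Sum>i\<in>UNIV. y i \<bullet> y i + (\<Sum>j\<in>UNIV. (t i j)\<^sup>2))"
    by (rule sum_mono)
  then have B: "F * h1\<^sup>2 * \<tau> \<le> (\<Sum>i\<in>UNIV. y i \<bullet> y i) + (\<Sum>i\<in>UNIV. \<Sum>j\<in>UNIV. (t i j)\<^sup>2)"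
    using sum_a by (simp add: sum.distrib flip: sum_distrib_left)
  \<comment> \<open>The gradient term 4 F h'^2 (z + F) loses 2 F h'^2 (z + F) to the bound
    \<open>B\<close> and 2 F^2 h'^2 to the eigenvalue part of \<open>A\<close>; only 2 F h'^2 z
    remains.\<close>
  have "F + 2 * (F * (F * h1\<^sup>2 + F * (1/2 - h1)\<^sup>2 / m)) + 2 * (F * h1\<^sup>2 * \<tau>)
      \<le> 4 * F * (h2 + h1\<^sup>2) * \<tau> + F * h1 * (2 * m - zz x)"
  proof -
    \<comment> \<open>The terms in \<open>u x \<bullet> w\<close> come from the drift on one side
      and the Hessian of z on the other, and cancel.\<close>
    have "F * h1 * (2 * m - u x \<bullet> w) - F * h1 * (zz x - u x \<bullet> w) = F * h1 * (2 * m - zz x)"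
      by (simp only: right_diff_distrib)
    moreover have "F' + 2 * A + 2 * B \<le> r + q3" if "F' + 2 * SA + 2 * SB + q1 \<le> r + q2"
      "q2 - q1 = q3" "A \<le> SA" "B \<le> SB" for F' A B r q1 q2 q3 SA SB :: real
      using that by simp
    ultimately show ?thesis using main A B by blast
  qed
  then have "F * (1 + 2 * (1/2 - h1)\<^sup>2 * F / m)
      \<le> F * (2 * h1\<^sup>2 * zz x + 4 * h2 * (zz x + F) + h1 * (2 * m - zz x))"
    unfolding \<tau>_def by (simp add: algebra_simps)
  then show ?thesis using F(2) by (simp add: m_def)
qed

end

section \<open>Properness and the maximum principle\<close>

text \<open>From h' <= 2/5 the gap 1/2 - h' is at least 1/10, so the F term on the left is at least
  F / (50 m) and dominates 4 h'' F. Also 2 h'^2 z <= (4/5) h' z and 4 h'' z <= 4 h', which leaves h'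
  (2 m + 4 - z/5) < 1 to be shown.\<close>

lemma barrier_inequality_contradiction:
  fixes m z F :: real
  assumes m: "m \<ge> 1" and z: "z \<ge> 0" and F: "F > 0"
  defines "K \<equiv> 100 * m\<^sup>2"
  defines "h1 \<equiv> 2/5 * z / (z + K)" and "h2 \<equiv> 2/5 * K / (z + K)\<^sup>2"
  shows "1 + 2 * (1/2 - h1)\<^sup>2 * F / m > 2 * h1\<^sup>2 * z + 4 * h2 * (z + F) + h1 * (2 * m - z)"
proof -
  have mm: "m \<le> m\<^sup>2" using m by (simp add: power2_eq_square)
  have K: "K \<ge> 100 * m" "K > 0" using mm m by (auto simp: K_def)
  have h1: "0 \<le> h1" "h1 \<le> 2/5" using z K by (auto simp: h1_def field_simps)
  have "(1/10)\<^sup>2 \<le> (1/2 - h1)\<^sup>2" using h1 by (intro power_mono) auto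
  then have 1: "F / (50 * m) \<le> 2 * (1/2 - h1)\<^sup>2 * F / m"
  proof -
    have "F / (50 * m) = 2 * (1/10)\<^sup>2 * F / m" using m by (simp add: power2_eq_square)
    also have "\<dots> \<le> 2 * (1/2 - h1)\<^sup>2 * F / m"
      using \<open>(1/10)\<^sup>2 \<le> (1/2 - h1)\<^sup>2\<close> F m by (intro divide_right_mono mult_right_mono) auto
    finally show ?thesis .
  qed
  have "h2 \<le> 2/5 / K"
  proof -
    have "K * K \<le> (z + K)\<^sup>2" using z K by (simp add: power2_eq_square mult_mono)
    then have "2/5 / K * (K * K / (z + K)\<^sup>2) \<le> 2/5 / K * 1"
      using K z by (intro mult_left_mono) auto
    then show ?thesis using K by (simp add: h2_def)
  qed
  also have "\<dots> \<le> 2/5 / (100 * m)" using K m by (intro divide_left_mono) auto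
  finally have "4 * h2 * F \<le> 4 * (2/5 / (100 * m)) * F"
    using F by (intro mult_right_mono mult_left_mono) auto
  also have "\<dots> \<le> F / (50 * m)" using F m by (simp add: field_simps)
  finally have 2: "4 * h2 * F \<le> F / (50 * m)" .
  have 3: "2 * h1\<^sup>2 * z \<le> 4/5 * (h1 * z)"
  proof -
    have "h1 * (h1 * z) \<le> 2/5 * (h1 * z)" using h1 z by (intro mult_right_mono) auto
    then show ?thesis by (simp add: power2_eq_square)
  qed
  have 4: "4 * h2 * z \<le> 4 * h1"
  proof -
    have "h2 * z = h1 * (K / (z + K))"
      by (simp only: h1_def h2_def power2_eq_square times_divide_eq_left times_divide_eq_right
          divide_divide_eq_left mult_ac)
    also have "\<dots> \<le> h1 * 1" using h1 K z by (intro mult_left_mono) auto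
    finally show ?thesis by simp
  qed
  have 5: "h1 * (2 * m + 4 - z / 5) < 1"
  proof (cases "z \<ge> 5 * (2 * m + 4)")
    case True
    then have "h1 * (2 * m + 4 - z / 5) \<le> 0" using h1 by (intro mult_nonneg_nonpos) auto
    then show ?thesis by simp
  next
    case False
    have "h1 * (2 * m + 4 - z / 5) \<le> h1 * (6 * m)" using h1 m z by (intro mult_left_mono) auto
    also have "h1 \<le> 2/5 * z / K" using z K by (auto simp: h1_def intro!: divide_left_mono mult_pos_pos)
    then have "h1 * (6 * m) \<le> 2/5 * z / K * (6 * m)" using m by (intro mult_right_mono) auto
    \<comment> \<open>Since m >= 1, the remaining case has z < 5 (2 m + 4) <= 30 m. The product
      becomes 72 m^2 / K, which explains the size of \<open>K\<close>.\<close>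
    also have "\<dots> \<le> 2/5 * (30 * m) / K * (6 * m)"
      using False m K by (intro mult_right_mono divide_right_mono) auto
    also have "\<dots> < 1" using m by (simp add: K_def power2_eq_square)
    finally show ?thesis .
  qed
  have 6: "2 * h1\<^sup>2 * z + 4 * h2 * (z + F) + h1 * (2 * m - z) =
      2 * h1\<^sup>2 * z + 4 * h2 * z + 4 * h2 * F + h1 * (2 * m) - h1 * z"
    by (simp add: algebra_simps)
  have 7: "h1 * (2 * m + 4 - z / 5) = h1 * (2 * m) + 4 * h1 - h1 * z / 5"
    by (simp add: algebra_simps)
  have "L < 1 + R" if "P \<le> R" "D \<le> P" "A \<le> 4/5 * G" "B \<le> 4 * H" "N < 1"
    "L = A + B + D + E - G" "N = E + 4 * H - G / 5" for A B D E G H L N P R :: real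
    using that by simp
  from this[OF 1 2 3 4 5 6 7] show ?thesis .
qed

text \<open>The intermediate point is kept because both uses depend on it: strict spacelikeness
  there makes \<open>u\<close> strictly contracting, and \<open>t > 0\<close> keeps it away from the
  start of a ray.\<close>

lemma smooth_increment_bound:
  assumes "smooth f"
  obtains t where "0 < t" "t < 1" "norm (f b - f a) \<le> norm (dd f (b - a) (a + t *\<^sub>R (b - a)))"
proof -
  have d: "((\<lambda>t. f (a + t *\<^sub>R (b - a))) has_derivative
      (\<lambda>s. s *\<^sub>R dd f (b - a) (a + t *\<^sub>R (b - a)))) (at t)" for t
    using has_vector_derivative_along_line[OF assms] by (simp add: has_vector_derivative_def)
  have "continuous_on {0..1} (\<lambda>t. f (a + t *\<^sub>R (b - a)))"
    by (intro continuous_at_imp_continuous_on ballI has_derivative_continuous[OF d])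
  from mvt_general[OF zero_less_one this d] that show thesis by auto
qed

section \<open>Energy of the normal part of the position vector, Lipschitz bound and
  properness\<close>

context spacelike_graph
begin

definition normal_energy :: "real^'m \<Rightarrow> real" where
  "normal_energy x = - pseudo_inner (normal_part X x (X x)) (normal_part X x (X x))"

lemma normal_position:
  obtains a where "\<And>v. (x - a) \<bullet> v = (u x - dd u a x) \<bullet> dd u v x"
    and "normal_energy x = (u x - dd u a x) \<bullet> (u x - dd u a x) - (x - a) \<bullet> (x - a)"
proof
  let ?a = "tangent_coeff x (X x)"
  show "(x - ?a) \<bullet> v = (u x - dd u ?a x) \<bullet> dd u v x" for v
    using tangent_coeff_normal[of "X x" x v]
    by (simp add: push_graph pseudo_inner_alt graph_immersion_def)
  show "normal_energy x = (u x - dd u ?a x) \<bullet> (u x - dd u ?a x) - (x - ?a) \<bullet> (x - ?a)"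
    by (simp add: normal_energy_def normal_part_eq push_graph pseudo_inner_alt graph_immersion_def)
qed

text \<open>Changing the coefficient of X^T by \<open>d\<close> adds a tangent vector to the normal
  residual; by orthogonality the energy drops by exactly \<open>g x d d\<close>. This is what makes
  the barrier lie below F.\<close>

lemma normal_energy_ge:
  "(u x - dd u a x) \<bullet> (u x - dd u a x) - (x - a) \<bullet> (x - a) \<le> normal_energy x"
proof -
  obtain a' where a': "\<And>v. (x - a') \<bullet> v = (u x - dd u a' x) \<bullet> dd u v x"
    "normal_energy x = (u x - dd u a' x) \<bullet> (u x - dd u a' x) - (x - a') \<bullet> (x - a')"
    by (rule normal_position[of x], rule that)
  define d where "d = a' - a"
  have "x - a = (x - a') + d" "u x - dd u a x = (u x - dd u a' x) + dd u d x"
    by (simp_all add: d_def dd_diff smooth_u)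
  have "(u x - dd u a x) \<bullet> (u x - dd u a x) - (x - a) \<bullet> (x - a) = normal_energy x - g x d d"
  proof -
    have "(p + q) \<bullet> (p + q) - (b + d) \<bullet> (b + d) = p \<bullet> p - b \<bullet> b - (d \<bullet> d - q \<bullet> q)"
      if "b \<bullet> d = p \<bullet> q" for p q :: "real^'n" and b d :: "real^'m"
      using that by (simp add: inner_add inner_commute)
    from this[OF a'(1)[of d]] show ?thesis
      unfolding a'(2) g_def \<open>x - a = (x - a') + d\<close> \<open>u x - dd u a x = (u x - dd u a' x) + dd u d x\<close> .
  qed
  then show ?thesis using g_nonneg[of x d] by simp
qed

text \<open>F = |X^T|^2 - z, with |X^T|^2 expanded in a smooth frame. Continuity serves the
  existence of the maximum.\<close>

lemma continuous_normal_energy: "continuous_on UNIV normal_energy"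
proof -
  obtain e where e: "\<And>i. smooth (e i)" "\<And>x. orthonormal x (\<lambda>i. e i x)"
    using smooth_orthonormal_frame by blast
  have "normal_energy x = (\<Sum>i\<in>UNIV. (x \<bullet> e i x - u x \<bullet> dd u (e i x) x)\<^sup>2) - zz x" for x
  proof -
    obtain a where a: "\<And>v. (x - a) \<bullet> v = (u x - dd u a x) \<bullet> dd u v x"
      "normal_energy x = (u x - dd u a x) \<bullet> (u x - dd u a x) - (x - a) \<bullet> (x - a)"
      by (rule normal_position[of x], rule that)
    have "x \<bullet> v - u x \<bullet> dd u v x = g x a v" for v
      using a(1)[of v] by (simp add: g_def inner_diff_left)
    then have "(\<Sum>i\<in>UNIV. (x \<bullet> e i x - u x \<bullet> dd u (e i x) x)\<^sup>2) = g x a a"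
      using orthonormal_Parseval[OF e(2), of x a a] by (simp add: power2_eq_square)
    then show ?thesis
      using a(1)[of a] a(2) by (simp add: g_def inner_diff_left inner_diff_right inner_commute)
  qed
  moreover have "continuous_on UNIV (\<lambda>x. (\<Sum>i\<in>UNIV. (x \<bullet> e i x - u x \<bullet> dd u (e i x) x)\<^sup>2) - zz x)"
    by (intro continuous_intros smooth_continuous e smooth_dd_along smooth_u)
  ultimately show ?thesis by simp
qed

lemma graph_strict_Lipschitz:
  assumes "a \<noteq> b" shows "norm (u b - u a) < norm (b - a)"
proof -
  obtain t where "norm (u b - u a) \<le> norm (dd u (b - a) (a + t *\<^sub>R (b - a)))"
    using smooth_increment_bound[OF smooth_u] by blast
  also have "\<dots> < norm (b - a)" using spacelike_u[of "b - a"] assms by (simp add: norm_lt)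
  finally show ?thesis .
qed

lemma graph_Lipschitz: "norm (u b - u a) \<le> norm (b - a)"
  using graph_strict_Lipschitz[of a b] by (cases "a = b") auto

lemma zz_nonneg:
  assumes "u 0 = 0" shows "zz x \<ge> 0"
  using graph_Lipschitz[of x 0] assms by (simp add: norm_le)

text \<open>A point of the unit sphere has slack \<open>\<delta>\<close> in \<open>norm (u x) < norm x\<close>, and by the Lipschitz
  property the slack persists along rays; this makes \<open>zz\<close> proper.\<close>

lemma zz_proper:
  assumes "u 0 = 0"
  shows "\<exists>\<delta>>0. \<forall>x. norm x \<ge> 1 \<longrightarrow> zz x \<ge> \<delta> * norm x"
proof -
  have "compact (sphere (0::real^'m) 1)" "sphere (0::real^'m) 1 \<noteq> {}" by auto
  moreover have "continuous_on (sphere 0 1) (\<lambda>x. norm (u x))"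
    by (intro continuous_intros smooth_continuous smooth_u)
  ultimately obtain y where y: "y \<in> sphere 0 1" "\<And>x. x \<in> sphere 0 1 \<Longrightarrow> norm (u x) \<le> norm (u y)"
    using continuous_attains_sup by metis
  define \<delta> where "\<delta> = 1 - norm (u y)"
  have "0 \<noteq> y" "norm y = 1" using y(1) by auto
  then have "\<delta> > 0" using graph_strict_Lipschitz[of 0 y] assms by (simp add: \<delta>_def)
  moreover have "zz x \<ge> \<delta> * norm x" if x: "norm x \<ge> 1" for x
  proof -
    define v where "v = x /\<^sub>R norm x"
    have x0: "norm x > 0" using x by linarith
    have "norm (x - v) = norm x - 1"
    proof -
      have "x - v = (1 - 1 / norm x) *\<^sub>R x" by (simp add: v_def scaleR_diff_left inverse_eq_divide)
      moreover have "\<bar>1 - 1 / norm x\<bar> = 1 - 1 / norm x"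
        using x x0 by (simp add: divide_le_eq_1)
      ultimately have "norm (x - v) = (1 - 1 / norm x) * norm x" by simp
      also have "\<dots> = norm x - 1" using x0 by (simp add: left_diff_distrib)
      finally show ?thesis .
    qed
    moreover have "norm (u v) \<le> norm (u y)" using x0 by (intro y(2)) (auto simp: v_def)
    moreover have "norm (u x) \<le> norm (u v) + norm (u x - u v)"
      using norm_triangle_ineq[of "u v" "u x - u v"] by simp
    ultimately have "norm (u x) \<le> norm x - \<delta>"
      using graph_Lipschitz[of x v] by (simp add: \<delta>_def)
    then have "\<delta> * norm x \<le> (norm x - norm (u x)) * (norm x + norm (u x))"
      using \<open>\<delta> > 0\<close> by (intro mult_mono) auto
    also have "\<dots> = zz x" by (simp add: algebra_simps flip: power2_norm_eq_inner power2_eq_square)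
    finally show ?thesis .
  qed
  ultimately show ?thesis by blast
qed

end

context graph_shrinker
begin

lemma normal_energy_nonpos:
  assumes growth: "\<And>x. normal_energy x \<le> C * exp (\<alpha> * zz x)" and "\<alpha> \<le> 1/3" and "C > 0"
  shows "normal_energy x1 \<le> 0"
proof (rule ccontr)
  assume "\<not> normal_energy x1 \<le> 0"
  then have pos1: "normal_energy x1 > 0" by simp
  note zz_nonneg = zz_nonneg[OF u_0]
  define m where "m = real CARD('m)"
  have m: "m \<ge> 1" by (simp add: m_def Suc_leI)
  define K where "K = 100 * m\<^sup>2"
  have K: "K > 0" using m by (simp add: K_def)
  define h where "h z = 2/5 * (z - K * ln (z + K))" for z
  define h1 where "h1 z = 2/5 * z / (z + K)" for z
  define h2 where "h2 z = 2/5 * K / (z + K)\<^sup>2" for z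
  have dh: "(h has_real_derivative h1 z) (at z)" if "z \<ge> 0" for z
    unfolding h_def[abs_def] using that K
    by (auto intro!: derivative_eq_intros simp: h1_def field_simps)
  have dh1: "(h1 has_real_derivative h2 z) (at z)" if "z \<ge> 0" for z
  proof -
    have "((\<lambda>z. 2/5 * (z / (z + K))) has_real_derivative
        2/5 * ((1 * (z + K) - z * (1 + 0)) / ((z + K) * (z + K)))) (at z)"
      using that K by (intro DERIV_cmult DERIV_divide DERIV_add DERIV_ident DERIV_const) auto
    then show ?thesis by (simp add: h1_def[abs_def] h2_def power2_eq_square)
  qed
  define \<Phi> where "\<Phi> x = normal_energy x * exp (- h (zz x))" for x
  have "\<Phi> x1 > 0" using pos1 by (simp add: \<Phi>_def)
  \<comment> \<open>The exponent is -z/15 plus a multiple of a logarithm.\<close>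
  have "((\<lambda>z. C * exp (z/3 - 2/5 * (z - K * ln (z + K)))) \<longlongrightarrow> 0) at_top"
    using K \<open>C > 0\<close> by real_asymp
  then have "eventually (\<lambda>z. C * exp (z/3 - h z) < \<Phi> x1) at_top"
    unfolding h_def using \<open>\<Phi> x1 > 0\<close> by (rule order_tendstoD)
  then obtain Z where Z: "\<And>z. z \<ge> Z \<Longrightarrow> C * exp (z/3 - h z) < \<Phi> x1"
    unfolding eventually_at_top_linorder by blast
  have small: "\<Phi> x < \<Phi> x1" if "zz x \<ge> Z" for x
  proof -
    have "\<alpha> * zz x \<le> 1/3 * zz x" using \<open>\<alpha> \<le> 1/3\<close> zz_nonneg by (rule mult_right_mono)
    then have "C * exp (\<alpha> * zz x) \<le> C * exp (zz x / 3)" using \<open>C > 0\<close> by simp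
    with growth[of x] have "normal_energy x \<le> C * exp (zz x / 3)" by (rule order_trans)
    then have "\<Phi> x \<le> C * exp (zz x / 3) * exp (- h (zz x))"
      unfolding \<Phi>_def by (rule mult_right_mono[OF _ exp_ge_zero])
    also have "\<dots> = C * exp (zz x / 3 - h (zz x))" by (simp add: mult.assoc flip: exp_add)
    also have "\<dots> < \<Phi> x1" using that by (rule Z)
    finally show ?thesis .
  qed
  obtain \<delta> where \<delta>: "\<delta> > 0" "\<And>x. norm x \<ge> 1 \<Longrightarrow> zz x \<ge> \<delta> * norm x"
    using zz_proper[OF u_0] by blast
  \<comment> \<open>The ball contains \<open>x1\<close>, and outside it \<open>\<Phi>\<close> is
    below \<open>\<Phi> x1\<close>; a maximum over the ball is therefore global.\<close>
  define R where "R = max (norm x1) (max 1 (Z / \<delta>))"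
  have out: "\<Phi> x < \<Phi> x1" if "norm x \<ge> R" for x
  proof (rule small)
    have "Z \<le> \<delta> * norm x" using that \<delta>(1) by (simp add: R_def field_simps)
    also have "\<dots> \<le> zz x" using that by (intro \<delta>(2)) (simp add: R_def)
    finally show "Z \<le> zz x" .
  qed
  have "continuous_on (cball 0 R) \<Phi>"
  proof -
    have "continuous_on (cball 0 R) (\<lambda>x. h (zz x))"
      unfolding h_def using zz_nonneg K
      by (intro continuous_intros smooth_continuous smooth_u ballI) (smt (verit))+
    then show ?thesis unfolding \<Phi>_def[abs_def]
      using continuous_on_subset[OF continuous_normal_energy subset_UNIV] by (intro continuous_intros)
  qed
  moreover have "x1 \<in> cball 0 R" by (simp add: R_def)
  ultimately obtain x0 where x0: "x0 \<in> cball 0 R" "\<And>x. x \<in> cball 0 R \<Longrightarrow> \<Phi> x \<le> \<Phi> x0"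
    using continuous_attains_sup[of "cball 0 R" \<Phi>] by (metis compact_cball empty_iff)
  have max: "\<Phi> x \<le> \<Phi> x0" for x
    using x0(2)[of x] x0(2)[OF \<open>x1 \<in> cball 0 R\<close>] out[of x] by (cases "x \<in> cball 0 R") auto
  define F where "F = normal_energy x0"
  have F: "F > 0"
    using max[of x1] \<open>\<Phi> x1 > 0\<close> unfolding \<Phi>_def F_def
    by (smt (verit) exp_gt_zero zero_less_mult_pos2)
  \<comment> \<open>Maximality of \<open>\<Phi>\<close> says that F <= Q(z) everywhere with equality
    at \<open>x0\<close>, which turns the weighted maximum into an additive one, as the barrier test
    requires.\<close>
  define Q where "Q z = \<Phi> x0 * exp (h z)" for z
  have Q0: "Q (zz x0) = F" by (simp add: Q_def \<Phi>_def F_def exp_minus)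
  have dQ: "(Q has_real_derivative Q z * h1 z) (at z)" if "z \<ge> 0" for z
    unfolding Q_def[abs_def] using dh[OF that] by (auto intro!: derivative_eq_intros)
  have dQ1: "((\<lambda>z. Q z * h1 z) has_real_derivative F * (h2 (zz x0) + (h1 (zz x0))\<^sup>2)) (at (zz x0))"
    using dQ[OF zz_nonneg[of x0]] dh1[OF zz_nonneg[of x0]]
    by (auto intro!: derivative_eq_intros simp: Q0 power2_eq_square algebra_simps)
  obtain a0 where a0: "\<And>v. (x0 - a0) \<bullet> v = (u x0 - dd u a0 x0) \<bullet> dd u v x0"
    "normal_energy x0 = (u x0 - dd u a0 x0) \<bullet> (u x0 - dd u a0 x0) - (x0 - a0) \<bullet> (x0 - a0)"
    by (rule normal_position[of x0], rule that)
  have "1 + 2 * (1/2 - h1 (zz x0))\<^sup>2 * F / real CARD('m)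
    \<le> 2 * (h1 (zz x0))\<^sup>2 * zz x0 + 4 * h2 (zz x0) * (zz x0 + F) + h1 (zz x0) * (2 * real CARD('m) - zz x0)"
  proof (rule maximum_point_inequality[OF dQ dQ1 _ zz_nonneg _ a0(1)])
    show "Q (zz x0) * h1 (zz x0) = F * h1 (zz x0)" by (simp add: Q0)
    show "F = (u x0 - dd u a0 x0) \<bullet> (u x0 - dd u a0 x0) - (x0 - a0) \<bullet> (x0 - a0)"
      using a0(2) by (simp add: F_def)
    show "F > 0" by (rule F)
    fix y a
    have "normal_energy y \<le> Q (zz y)"
    proof -
      have "normal_energy y = \<Phi> y * exp (h (zz y))" by (simp add: \<Phi>_def exp_minus)
      also have "\<dots> \<le> Q (zz y)" unfolding Q_def using max by (intro mult_right_mono) auto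
      finally show ?thesis .
    qed
    then have "(u y - dd u a y) \<bullet> (u y - dd u a y) - (y - a) \<bullet> (y - a) - Q (zz y) \<le> 0"
      using normal_energy_ge[of y a] by simp
    then show "(u y - dd u a y) \<bullet> (u y - dd u a y) - (y - a) \<bullet> (y - a) - Q (zz y)
      \<le> (u x0 - dd u a0 x0) \<bullet> (u x0 - dd u a0 x0) - (x0 - a0) \<bullet> (x0 - a0) - Q (zz x0)"
      using a0(2) by (simp add: Q0 F_def)
  qed
  with barrier_inequality_contradiction[OF m zz_nonneg[of x0] F]
  show False by (simp add: h1_def h2_def K_def m_def)
qed

text \<open>The coefficient \<open>a = y\<close> at the point \<open>y\<close> annihilates the
  positive part of the residual and leaves |u - Du y|^2 <= 0. Differentiating u = Du y gives D^2 u
  (y, .) = 0, so Du x is constant along the ray from 0 through \<open>x\<close>.\<close>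

lemma linear_of_normal_energy_nonpos:
  assumes "\<And>x. normal_energy x \<le> 0"
  shows "u x = dd u x 0"
proof -
  have hom: "u y = dd u y y" for y
  proof -
    have "(u y - dd u y y) \<bullet> (u y - dd u y y) \<le> 0"
      using normal_energy_ge[of y y] assms[of y] by simp
    then show ?thesis by (metis inner_gt_zero_iff not_less right_minus_eq)
  qed
  have flat: "dd (dd u y) v y = 0" for y v
  proof -
    have "((\<lambda>y. dd u y y) has_derivative (\<lambda>v. dd (dd u y) v y + dd u (dd (\<lambda>y. y) v y) y)) (at y)"
      by (intro has_derivative_dd_along smooth_u differentiable_ident)
    then have "(u has_derivative (\<lambda>v. dd (dd u y) v y + dd u v y)) (at y)"
      by (simp add: dd_def[of "\<lambda>y. y"] flip: hom)
    from fun_cong[OF has_derivative_unique[OF this smooth_has_derivative[OF smooth_u]], of v]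
    show ?thesis by simp
  qed
  \<comment> \<open>The flatness at t x comes with a factor t, which can be cancelled only away from
    the origin.\<close>
  have flat': "dd (dd u x) x (t *\<^sub>R x) = 0" if "t > 0" for t
    using flat[of "t *\<^sub>R x" x] that linear_scale[OF linear_dd_dd[OF smooth_u]] by simp
  obtain t where "0 < t" "norm (dd u x x - dd u x 0) \<le> norm (dd (dd u x) (x - 0) (0 + t *\<^sub>R (x - 0)))"
    using smooth_increment_bound[OF smooth_dd[OF smooth_u]] by blast
  then have "dd u x x = dd u x 0" using flat'[of t] by simp
  then show ?thesis using hom[of x] by simp
qed

end

theorem corollary5p2:
  fixes u :: "real^'m \<Rightarrow> real^'n"
    and X :: "real^'m \<Rightarrow> (real^'m) \<times> (real^'n)"
    and M :: "((real^'m) \<times> (real^'n)) set"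
    and \<alpha> C :: real
  assumes "smooth_on UNIV u"
    and "X = graph_immersion u"
    and "M = range X"
    and "spacelike X"
    and "self_shrinker X"
    and "0 \<in> M"
    and "\<alpha> < 1 / 6 + 1 / (6 * sqrt (real CARD('m)))"
    and "C > 0"
    and "\<forall>x. (pseudo_norm (mean_curvature X x))\<^sup>2 \<le> C * exp (\<alpha> * z_fun X x)"
  shows "subspace M"
proof -
  have X: "X x = (x, u x)" for x using assms(2) by (simp add: graph_immersion_def)
  interpret spacelike_graph u
  proof
    show "smooth u" by (rule assms(1))
    show "dd u v x \<bullet> dd u v x < v \<bullet> v" if "v \<noteq> 0" for v x
      using assms(4) that unfolding spacelike_def induced_metric_def assms(2)
      by (simp add: push_graph_immersion[OF assms(1)] pseudo_inner_alt)
  qed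
  interpret graph_shrinker u
  proof
    show "hess_trace x = (1/2) *\<^sub>R (dd u x x - u x)" for x
      using self_shrinker_graph_equation assms(2,5) by simp
    show "u 0 = 0" using assms(3,6) X by (auto simp: zero_prod_def)
  qed
  have "sqrt (real CARD('m)) \<ge> 1" by (simp add: Suc_leI)
  then have "1 / (6 * sqrt (real CARD('m))) \<le> 1/6" by (simp add: field_simps)
  then have "\<alpha> \<le> 1/3" using assms(7) by linarith
  moreover have "normal_energy x \<le> (4 * C) * exp (\<alpha> * zz x)" for x
  proof -
    have H: "mean_curvature X x = (- 1/2) *\<^sub>R normal_part X x (X x)"
      using assms(5) by (simp add: self_shrinker_def)
    have "pseudo_inner (mean_curvature X x) (mean_curvature X x) = - normal_energy x / 4"
      unfolding H pseudo_inner_scaleR_left pseudo_inner_scaleR_right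
      by (simp add: normal_energy_def assms(2))
    \<comment> \<open>The factor 1/4 is the square of the 1/2 in H = - X^N / 2; it turns
      \<open>C\<close> into \<open>4 * C\<close>.\<close>
    then have "normal_energy x / 4 \<le> (pseudo_norm (mean_curvature X x))\<^sup>2"
      by (simp add: pseudo_norm_def)
    also have "\<dots> \<le> C * exp (\<alpha> * zz x)"
      using assms(9)[rule_format, of x] by (simp add: z_fun_def X pseudo_inner_alt)
    finally show ?thesis by simp
  qed
  ultimately have "u x = dd u x 0" for x
    using normal_energy_nonpos[of "4 * C" \<alpha>] assms(8) by (intro linear_of_normal_energy_nonpos) auto
  then have "linear u" using linear_dd[OF smooth_u, of 0] by (metis ext)
  then have "linear X" unfolding X[abs_def]
    by (intro linearI) (simp_all add: linear_add linear_scale)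
  then show ?thesis unfolding assms(3) by (intro linear_subspace_image subspace_UNIV)
qed

end
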